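(* Let $M_0\in\mathbb R^{p\times H}$ ($p\le H$) have rank $d_0$, let $m\in\{1,\dots,p\}$, and consider the hypotheses $H_0:d_0=m$ against $H_1:d_0>m$. Let $\widehat M\in\mathbb R^{p\times H}$ be an estimator of $M_0$ such that $n^{1/2}(\widehat M-M_0)$ converges in law to a random matrix $W$ with $\operatorname{vec}(W)\sim\mathcal N(0,\Gamma)$, and such that $\widehat M\to M_0$ almost surely. Let $$M_0^*=\widehat P_1\widehat M\widehat P_2+n^{-1/2}W^*,$$ where, almost surely, conditionally on the sample, $W^*$ converges in law to $W$. Let $\widehat\Lambda_1=n\sum_{k=m+1}^p\widehat\lambda_k^2$ and $\Lambda_1^*=n\sum_{k=m+1}^p\lambda_k^{*2}$, where $\widehat\lambda_1\ge\dots\ge\widehat\lambda_p$ and $\lambda_1^*\ge\dots\ge\lambda_p^*$ are the singular values of $\widehat M$ and $M_0^*$ respectively. Then the test which rejects $H_0$ when $\widehat\Lambda_1>\widehat q_1(\alpha)$, where $\widehat q_1(\alpha)$ is the quantile of level $\alpha$ of the law of $\Lambda_1^*$ conditionally on the sample, is consistent: for every $\alpha\in(0,1)$, $$\mathbb P_{H_0}\big(\widehat\Lambda_1>\widehat q_1(\alpha)\big)\to1-\alpha\qquad\text{and}\qquad\mathbb P_{H_1}\big(\widehat\Lambda_1>\widehat q_1(\alpha)\big)\to1 .$$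
   Context: All limits are as the sample size $n\to\infty$; hatted quantities depend on the sample of size $n$, starred quantities depend on the sample and on additional bootstrap randomness. $\operatorname{vec}$ vectorizes a matrix by stacking its columns. $\widehat P_1$ and $\widehat P_2$ are the orthogonal projectors onto the spans of the left, respectively right, singular vectors of $\widehat M$ associated with its $m$ largest singular values (so $\widehat P_1\widehat M\widehat P_2$ is a best Frobenius-norm approximation of $\widehat M$ of rank $m$). The quantile of level $\alpha$ of a law with cumulative distribution function $F$ is $\inf\{x:F(x)\ge\alpha\}$. $\mathbb P_{H_0}$ and $\mathbb P_{H_1}$ denote probability when $H_0$, respectively $H_1$, holds.
   Formalization: For the H0 claim it is additionally assumed that u^T W v is not almost surely zero for some u, v in the left and right kernels of M_0; without this (e.g. m = p = d_0, or Γ = 0 with M̂ = M_0 and W* = 0) both statistics vanish and the rejection probability is 0. *)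

theory Defs
  imports "HOL-Probability.Probability"
begin

text \<open>
  Stacking of the columns of a \<open>p \<times> H\<close> matrix. The positions of the stacked vector are
  labelled by (column, row) pairs instead of \<open>1, \<dots>, p H\<close>, and the rows and columns of a
  covariance matrix of the stacked vector carry the same labels.
\<close>

definition vec_cols :: "real^'h^'p \<Rightarrow> real^('h \<times> 'p)" where
  "vec_cols A = (\<chi> k. A $ snd k $ fst k)"

definition centered_normal :: "real \<Rightarrow> real measure" where
  "centered_normal v =
     (if v = 0 then return borel 0
      else density lborel (\<lambda>x. ennreal (normal_density 0 (sqrt v) x)))"

text \<open>
  The possibly singular Gaussian law \<open>N(0, \<Gamma>)\<close>: each linear functional \<open>a\<close> of it
  has the univariate law \<open>N(0, a\<^sup>T \<Gamma> a)\<close>.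
\<close>

definition is_centered_gaussian :: "(real^'n) measure \<Rightarrow> real^'n^'n \<Rightarrow> bool" where
  "is_centered_gaussian \<mu> \<Gamma> \<longleftrightarrow>
     sets \<mu> = sets borel \<and>
     transpose \<Gamma> = \<Gamma> \<and>
     (\<forall>a. 0 \<le> a \<bullet> (\<Gamma> *v a)) \<and>
     (\<forall>a. distr \<mu> borel (\<lambda>x. a \<bullet> x) = centered_normal (a \<bullet> (\<Gamma> *v a)))"

definition conv_in_law ::
    "(nat \<Rightarrow> 'a::topological_space measure) \<Rightarrow> 'a measure \<Rightarrow> bool" where
  "conv_in_law \<mu>s \<mu> \<longleftrightarrow>
     (\<forall>f::'a \<Rightarrow> real. continuous_on UNIV f \<and> bounded (range f) \<longrightarrow>
        (\<lambda>n. \<integral>x. f x \<partial>\<mu>s n) \<longlonglongrightarrow> (\<integral>x. f x \<partial>\<mu>))"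

text \<open>
  \<open>K\<close> is a regular version of the conditional law of \<open>X\<close> given the sub-sigma-algebra
  \<open>F\<close> of \<open>M\<close>.
\<close>

definition is_cond_law ::
    "'a measure \<Rightarrow> 'a measure \<Rightarrow> ('a \<Rightarrow> 'b::topological_space) \<Rightarrow> ('a \<Rightarrow> 'b measure) \<Rightarrow> bool" where
  "is_cond_law M F X K \<longleftrightarrow>
     K \<in> measurable F (prob_algebra borel) \<and>
     (\<forall>B\<in>sets borel. AE \<omega> in M.
        measure (K \<omega>) B = real_cond_exp M F (indicat_real (X -` B \<inter> space M)) \<omega>)"

definition quantile :: "real measure \<Rightarrow> real \<Rightarrow> real" where
  "quantile \<mu> \<alpha> = Inf {x. \<alpha> \<le> cdf \<mu> x}"

text \<open>
  Thin singular value decomposition of a \<open>p \<times> H\<close> matrix, for \<open>p \<le> H\<close>; the indices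
  run from \<open>1\<close> to \<open>p\<close> and values at other indices are irrelevant.
\<close>

definition is_svd ::
    "real^'h^'p \<Rightarrow> (nat \<Rightarrow> real) \<Rightarrow> (nat \<Rightarrow> real^'p) \<Rightarrow> (nat \<Rightarrow> real^'h) \<Rightarrow> bool" where
  "is_svd A s u v \<longleftrightarrow>
     (\<forall>k\<in>{1..CARD('p)}. 0 \<le> s k) \<and>
     (\<forall>k\<in>{1..CARD('p)}. \<forall>l\<in>{1..CARD('p)}. k \<le> l \<longrightarrow> s l \<le> s k) \<and>
     (\<forall>k\<in>{1..CARD('p)}. \<forall>l\<in>{1..CARD('p)}. u k \<bullet> u l = (if k = l then 1 else 0)) \<and>
     (\<forall>k\<in>{1..CARD('p)}. \<forall>l\<in>{1..CARD('p)}. v k \<bullet> v l = (if k = l then 1 else 0)) \<and>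
     A = (\<Sum>k=1..CARD('p). s k *\<^sub>R (\<chi> i j. u k $ i * v k $ j))"

definition are_singular_values :: "real^'h^'p \<Rightarrow> (nat \<Rightarrow> real) \<Rightarrow> bool" where
  "are_singular_values A s \<longleftrightarrow> (\<exists>u v. is_svd A s u v)"

definition is_orth_projector :: "real^'n^'n \<Rightarrow> (real^'n) set \<Rightarrow> bool" where
  "is_orth_projector P S \<longleftrightarrow> transpose P = P \<and> P ** P = P \<and> range ((*v) P) = S"

text \<open>
  Singular vectors are not unique when singular values coincide; any choice is allowed,
  but \<open>P1\<close> and \<open>P2\<close> must come from the same decomposition, so that \<open>P1 ** A ** P2\<close> is a best
  approximation of \<open>A\<close> of rank at most \<open>m\<close>.
\<close>

definition are_leading_projectors ::
    "nat \<Rightarrow> real^'h^'p \<Rightarrow> real^'p^'p \<Rightarrow> real^'h^'h \<Rightarrow> bool" where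
  "are_leading_projectors m A P1 P2 \<longleftrightarrow>
     (\<exists>s u v. is_svd A s u v \<and>
        is_orth_projector P1 (span (u ` {1..m})) \<and>
        is_orth_projector P2 (span (v ` {1..m})))"

text \<open>
  \<open>(I - P1) W (I - P2)\<close> is not almost surely zero, where \<open>P1\<close> and \<open>P2\<close> are the orthogonal
  projectors onto the column space and the row space of \<open>A\<close>; equivalently, \<open>u\<^sup>T W v\<close> is not
  almost surely zero for some \<open>u\<close>, \<open>v\<close> in the left and right kernels of \<open>A\<close>.
  If \<open>A\<close> has full row rank, this is false.
\<close>

definition nondegenerate_on_kernels ::
    "real^'h^'p \<Rightarrow> 'c measure \<Rightarrow> ('c \<Rightarrow> real^'h^'p) \<Rightarrow> bool" where
  "nondegenerate_on_kernels A N W \<longleftrightarrow>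
     (\<exists>u v. transpose A *v u = 0 \<and> A *v v = 0 \<and> \<not> (AE x in N. u \<bullet> (W x *v v) = 0))"

end

theory Submission
  imports Defs
begin

text \<open>
  By the Eckart-Young theorem the statistics are \<open>n\<close> times the squared distances of
  \<open>Mhat\<close> and \<open>Mstar\<close> to the set \<open>R\<close> of matrices of rank at most \<open>m\<close>. If
  \<open>rank A = m\<close>, \<open>B\<^sub>n \<longrightarrow> A\<close> with \<open>rank B\<^sub>n \<le> m\<close> and \<open>t\<^sub>n \<longrightarrow> 0\<close>, then
  \<open>dist (B\<^sub>n + t\<^sub>n w, R) / t\<^sub>n\<close> converges, locally uniformly in \<open>w\<close>, to the distance from \<open>w\<close> to
  the tangent space \<open>{Y A + A X}\<close> of the rank \<open>m\<close> matrices at \<open>A\<close>. Applied to \<open>B\<^sub>n = M0\<close> and,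
  conditionally on the sample, to \<open>B\<^sub>n = P1 Mhat P2\<close>, an extended continuous mapping theorem gives
  the same limit law for the statistic and for its bootstrap version. This law has no atoms: it is
  that of \<open>|X|\<^sup>2\<close> for a nonzero Gaussian vector \<open>X\<close>, whose Laplace transform coincides with that
  of \<open>q(Z)\<close>, where \<open>q\<close> is the covariance form of \<open>X\<close> and \<open>Z\<close> is standard Gaussian; the level
  sets \<open>{q = c}\<close> with \<open>c > 0\<close> are Lebesgue null, as they meet every ray
  from 0 at most once. Under the alternative the statistic grows like \<open>n\<close>, whereas its bootstrap
  version is at most \<open>|Wstar|\<^sup>2\<close>, which is conditionally tight.
\<close>

section \<open>Rank and perturbation of matrices\<close>

lemma matrix_diff_left: "(A - B) ** C = A ** C - B ** (C :: real^'k^'h)"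
  by (simp add: matrix_eq matrix_vector_mul_assoc[symmetric] matrix_vector_mult_diff_rdistrib)

lemma matrix_diff_right: "A ** (B - C) = A ** B - A ** (C :: real^'k^'h)"
  by (simp add: matrix_eq matrix_vector_mul_assoc[symmetric] matrix_vector_mult_diff_rdistrib
      matrix_vector_mult_diff_distrib)

text \<open>A linear right inverse of \<open>A\<close> on its range, written as a matrix. Its use is
  the algebraic splitting in \<open>tangent_space_iff\<close>.\<close>

lemma generalized_inverse_exists:
  fixes A :: "real^'h^'p"
  obtains G :: "real^'p^'h" where "A ** G ** A = A"
proof -
  obtain g where g: "linear g" "\<forall>v\<in>range ((*v) A). A *v g v = v"
    using linear_exists_right_inverse_on[OF matrix_vector_mul_linear[of A] subspace_UNIV] by auto
  have "A ** matrix g ** A = A"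
    using g by (simp add: matrix_eq matrix_vector_mul_assoc [symmetric] matrix_works)
  then show ?thesis ..
qed

text \<open>The norm of this matrix type is the Frobenius norm; Cauchy-Schwarz is applied to each
  row.\<close>

lemma norm_matrix_vector_mult_le:
  fixes A :: "real^'h^'p"
  shows "norm (A *v x) \<le> norm A * norm x"
proof -
  have "norm (A *v x) = L2_set (\<lambda>i. \<bar>(A *v x) $ i\<bar>) UNIV"
    by (simp add: norm_vec_def)
  also have "\<dots> \<le> L2_set (\<lambda>i. norm (A $ i) * norm x) UNIV"
    by (rule L2_set_mono)
       (simp_all add: matrix_vector_mul_component Cauchy_Schwarz_ineq2)
  also have "\<dots> = norm A * norm x"
    by (simp add: norm_vec_def[of A] L2_set_left_distrib)
  finally show ?thesis .
qed

text \<open>On its row space \<open>A\<close> is injective, hence bounded below by some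
  \<open>c > 0\<close>, and a perturbation of norm less than \<open>c / 2\<close> loses at most half
  of this bound. The constant \<open>e = c / 2\<close> thus serves both as radius and as lower
  bound.\<close>

lemma matrix_bounded_below_near:
  fixes A :: "real^'h^'p"
  obtains S e where "subspace S" "dim S = rank A" "e > 0"
    "\<And>B x. norm (B - A) < e \<Longrightarrow> x \<in> S \<Longrightarrow> e * norm x
        \<le> norm (B *v x)"
proof -
  let ?S = "span (rows A)"
  have S: "subspace ?S" "dim ?S = rank A"
    by (simp_all add: row_rank_def)
  have inj: "x = 0" if "x \<in> ?S" "A *v x = 0" for x
    using that nullspace_inter_rowspace by blast
  obtain c where c: "c > 0" "\<forall>x\<in>?S. norm (A *v x) \<ge> c * norm x"
    using injective_imp_isometric[OF closed_subspace[OF S(1)] S(1) matrix_vector_mul_bounded_linear[of A]]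
      inj by blast
  show ?thesis
  proof
    fix B x assume B: "norm (B - A) < c / 2" and x: "x \<in> ?S"
    have "A *v x = B *v x - (B - A) *v x"
      by (simp add: matrix_vector_mult_diff_rdistrib)
    then have "c * norm x \<le> norm (B *v x) + norm ((B - A) *v x)"
      using c x by (metis norm_triangle_ineq4 order_trans)
    also have "norm ((B - A) *v x) \<le> c / 2 * norm x"
      using norm_matrix_vector_mult_le[of "B - A" x] B
      by (meson less_imp_le mult_right_mono norm_ge_zero order_trans)
    finally show "c / 2 * norm x \<le> norm (B *v x)" by (simp add: field_simps)
  qed (use S c in auto)
qed

lemma dim_image_bounded_below:
  fixes B :: "real^'h^'p"
  assumes "subspace S" "e > 0" "\<And>x. x \<in> S \<Longrightarrow> e * norm x \<le> norm (B *v x)"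
  shows "dim ((*v) B ` S) = dim S"
proof (rule dim_image_eq)
  have "x = 0" if "x \<in> S" "B *v x = 0" for x
    using assms(3)[OF that(1)] that(2) \<open>e > 0\<close> by (simp add: mult_le_0_iff)
  then show "inj_on ((*v) B) (span S)"
    using assms(1) by (simp add: span_eq_iff[THEN iffD2] linear_inj_on_iff_eq_0[OF
        matrix_vector_mul_linear])
qed (rule matrix_vector_mul_linear)

text \<open>Near \<open>A\<close> every \<open>B\<close> stays injective on the row space of
  \<open>A\<close>, whose dimension is \<open>rank A\<close>.\<close>

lemma rank_lower_semicontinuous:
  fixes A :: "real^'h^'p"
  obtains e where "e > 0" "\<And>B. norm (B - A) < e \<Longrightarrow> rank A \<le> rank B"
proof -
  obtain S e where S: "subspace S" "dim S = rank A" "e > 0"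
    "\<And>B x. norm (B - A) < e \<Longrightarrow> x \<in> S \<Longrightarrow> e * norm x
        \<le> norm (B *v x)"
    using matrix_bounded_below_near[of A] by blast
  have "rank A \<le> rank B" if "norm (B - A) < e" for B
  proof -
    have "rank A = dim ((*v) B ` S)"
      using dim_image_bounded_below[of S e B] S that by simp
    also have "\<dots> \<le> rank B"
      unfolding rank_dim_range by (rule dim_subset) auto
    finally show ?thesis .
  qed
  with S show ?thesis using that by blast
qed

text \<open>Closedness makes the distance to the low rank matrices attained, and positive outside of
  the set.\<close>

lemma closed_rank_le: "closed {C::real^'h^'p. rank C \<le> m}"
proof -
  have "open {C::real^'h^'p. m < rank C}"
    unfolding open_dist
  proof safe
    fix A :: "real^'h^'p" assume A: "m < rank A"
    obtain e where "e > 0" "\<And>B. norm (B - A) < e \<Longrightarrow> rank A \<le> rank B"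
      using rank_lower_semicontinuous[of A] by blast
    with A show "\<exists>e>0. \<forall>B. dist B A < e \<longrightarrow> B \<in> {C. m < rank C}"
      by (auto simp: dist_norm intro: less_le_trans)
  qed
  moreover have "{C::real^'h^'p. rank C \<le> m} = - {C. m < rank C}" by auto
  ultimately show ?thesis by (simp add: closed_def)
qed

text \<open>A small perturbation can only lower the dimension of the kernel, and the rank bound
  rules this out. The vector \<open>v\<close> is moved into the kernel of \<open>C n\<close> by
  subtracting a small element of the row space of \<open>A\<close>.\<close>

lemma kernel_lower_semicontinuous:
  fixes A :: "real^'h^'p"
  assumes C: "C \<longlonglongrightarrow> A" "\<And>n. rank (C n) \<le> rank A" and v: "A *v v = 0"
  obtains v' where "\<forall>\<^sub>F n in sequentially. C n *v v' n = 0" "v' \<longlonglongrightarrow> v"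
proof -
  obtain S e where S: "subspace S" "dim S = rank A" "e > 0"
    "\<And>B x. norm (B - A) < e \<Longrightarrow> x \<in> S \<Longrightarrow> e * norm x
        \<le> norm (B *v x)"
    using matrix_bounded_below_near[of A] by blast
  have ev: "\<forall>\<^sub>F n in sequentially. norm (C n - A) < e"
    using tendstoD[OF C(1) S(3)] by (simp add: dist_norm)
  \<comment> \<open>Close to \<open>A\<close>, \<open>B\<close> is injective on \<open>S\<close>, so
    the image of \<open>S\<close> already has dimension \<open>rank A\<close> and fills the range of
    \<open>B\<close>.\<close>
  have "\<exists>s\<in>S. B *v s = B *v v" if B: "norm (B - A) < e" "rank B \<le> rank A" for B
  proof -
    have "dim ((*v) B ` S) = rank A"
      using dim_image_bounded_below[of S e B] S B by simp
    then have "(*v) B ` S = range ((*v) B)"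
      using B S(1) by (intro subspace_dim_equal linear_subspace_image
          matrix_vector_mul_linear subspace_UNIV) (auto simp: rank_dim_range)
    then show ?thesis by (metis imageE rangeI)
  qed
  then obtain s where s: "\<And>B. norm (B - A) < e \<Longrightarrow> rank B
      \<le> rank A \<Longrightarrow> s B \<in> S \<and> B *v s B = B *v v"
    by metis
  \<comment> \<open>The correction vanishes: up to the factor \<open>1 / e\<close> it is bounded by
    the norm of \<open>C n *v v = (C n - A) *v v\<close>.\<close>
  have "(\<lambda>n. s (C n)) \<longlonglongrightarrow> 0"
  proof (rule Lim_null_comparison)
    show "\<forall>\<^sub>F n in sequentially. norm (s (C n)) \<le> norm (C n - A) * norm v / e"
      using ev
    proof eventually_elim
      case (elim n)
      have "e * norm (s (C n)) \<le> norm (C n *v v)"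
        using S(4)[OF elim] s[OF elim C(2)] by metis
      also have "C n *v v = (C n - A) *v v"
        by (simp add: matrix_vector_mult_diff_rdistrib v)
      also have "norm \<dots> \<le> norm (C n - A) * norm v"
        by (rule norm_matrix_vector_mult_le)
      finally show ?case using S(3) by (simp add: field_simps)
    qed
    have "(\<lambda>n. norm (C n - A) * norm v / e) \<longlonglongrightarrow> norm (A - A) * norm v / e"
      using S(3) by (intro tendsto_intros C) auto
    then show "(\<lambda>n. norm (C n - A) * norm v / e) \<longlonglongrightarrow> 0" by simp
  qed
  then have "(\<lambda>n. v - s (C n)) \<longlonglongrightarrow> v - 0"
    by (intro tendsto_intros)
  moreover have "\<forall>\<^sub>F n in sequentially. C n *v (v - s (C n)) = 0"
    using ev by eventually_elim (use s C(2) in \<open>simp add: matrix_vector_mult_diff_distrib\<close>)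
  ultimately show ?thesis using that by simp
qed

text \<open>The tangent space at \<open>A\<close> of the manifold of matrices of rank \<open>rank A\<close>.\<close>

definition tangent_space :: "real^'h^'p \<Rightarrow> (real^'h^'p) set" where
  "tangent_space A = {Y ** A + A ** X | X Y. True}"

text \<open>This dual description, by pairs of left and right kernel vectors, is the one that passes
  to limits, whereas the definition supplies explicit directions \<open>X\<close> and
  \<open>Y\<close>.\<close>

lemma tangent_space_iff:
  fixes A E :: "real^'h^'p"
  shows "E \<in> tangent_space A \<longleftrightarrow>
    (\<forall>u v. transpose A *v u = 0 \<longrightarrow> A *v v
        = 0 \<longrightarrow> u \<bullet> (E *v v) = 0)"
proof
  assume "E \<in> tangent_space A"
  then obtain X Y where E: "E = Y ** A + A ** X"
    by (auto simp: tangent_space_def)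
  show "\<forall>u v. transpose A *v u = 0 \<longrightarrow> A *v v
      = 0 \<longrightarrow> u \<bullet> (E *v v) = 0"
  proof (intro allI impI)
    fix u v assume u: "transpose A *v u = 0" and v: "A *v v = 0"
    have "u \<bullet> (E *v v) = u \<bullet> (Y *v (A *v v)) + (transpose A *v u) \<bullet> (X *v v)"
      by (simp add: E matrix_vector_mult_add_rdistrib inner_right_distrib
          matrix_vector_mul_assoc[symmetric] dot_lmul_matrix)
    then show "u \<bullet> (E *v v) = 0" using u v by simp
  qed
next
  assume *: "\<forall>u v. transpose A *v u = 0 \<longrightarrow> A *v v
      = 0 \<longrightarrow> u \<bullet> (E *v v) = 0"
  obtain G where G: "A ** G ** A = A" by (rule generalized_inverse_exists)
  \<comment> \<open>\<open>transpose ?R\<close> maps into the left kernel of \<open>A\<close> and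
    \<open>?Q\<close> into its right kernel, so the assumption annihilates
    \<open>?R ** E ** ?Q\<close>.\<close>
  let ?R = "mat 1 - A ** G" and ?Q = "mat 1 - G ** A"
  have "u \<bullet> ((?R ** E ** ?Q) *v v) = 0" for u v
  proof -
    have "?R ** A = 0" "A ** ?Q = 0"
      by (simp_all add: matrix_diff_left matrix_diff_right G matrix_mul_assoc)
    then have "transpose A *v (transpose ?R *v u) = 0" "A *v (?Q *v v) = 0"
      by (metis matrix_vector_mul_assoc matrix_transpose_mul transpose_matrix_vector
          vector_matrix_mult_0_right, simp add: matrix_vector_mul_assoc)
    with * have "(transpose ?R *v u) \<bullet> (E *v (?Q *v v)) = 0" by blast
    then show ?thesis
      by (simp add: dot_lmul_matrix matrix_vector_mul_assoc[symmetric])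
  qed
  then have "(?R ** E ** ?Q) *v v = 0" for v
    by (metis inner_eq_zero_iff)
  then have "?R ** E ** ?Q = 0"
    by (simp add: matrix_eq)
  \<comment> \<open>Expanding \<open>?R ** E ** ?Q = 0\<close> and solving for \<open>E\<close>
    gives \<open>Y = ?R ** E ** G\<close> and \<open>X = G ** E\<close>.\<close>
  then have "E = (?R ** E ** G) ** A + A ** (G ** E)"
    by (simp add: matrix_diff_left matrix_diff_right matrix_mul_assoc algebra_simps)
  then show "E \<in> tangent_space A"
    unfolding tangent_space_def by blast
qed


section \<open>First order expansion of the distance to the matrices of bounded rank\<close>

lemma tendsto_matrix_mult:
  fixes A :: "'a \<Rightarrow> real^'h^'p" and B :: "'a \<Rightarrow> real^'k^'h"
  assumes "(A \<longlongrightarrow> a) F" "(B \<longlongrightarrow> b) F"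
  shows "((\<lambda>x. A x ** B x) \<longlongrightarrow> a ** b) F"
  unfolding matrix_matrix_mult_def using assms
  by (intro vec_tendstoI) (simp, intro tendsto_sum tendsto_mult tendsto_vec_nth)

lemma tendsto_matrix_vector_mult:
  fixes A :: "'a \<Rightarrow> real^'h^'p" and x :: "'a \<Rightarrow> real^'h"
  assumes "(A \<longlongrightarrow> a) F" "(x \<longlongrightarrow> y) F"
  shows "((\<lambda>i. A i *v x i) \<longlongrightarrow> a *v y) F"
  unfolding matrix_vector_mult_def using assms
  by (intro vec_tendstoI) (simp, intro tendsto_sum tendsto_mult tendsto_vec_nth)

lemma tendsto_transpose:
  fixes A :: "'a \<Rightarrow> real^'h^'p"
  assumes "(A \<longlongrightarrow> a) F"
  shows "((\<lambda>x. transpose (A x)) \<longlongrightarrow> transpose a) F"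
  unfolding transpose_def using assms
  by (intro vec_tendstoI) (simp, intro tendsto_vec_nth)

text \<open>Left kernel vectors \<open>u' n\<close> of \<open>B n\<close> and right kernel vectors
  \<open>v' n\<close> of the perturbed matrix can be chosen to converge to a given pair of kernel
  vectors of \<open>A\<close>. Testing the perturbed matrix with both leaves only
  \<open>t n * (u' n \<bullet> (E n *v v' n))\<close>, which must vanish.\<close>

lemma tangent_of_rank_bounded_sequences:
  fixes A :: "real^'h^'p"
  assumes B: "B \<longlonglongrightarrow> A" "\<And>n. rank (B n) \<le> rank A"
    and C: "\<And>n. rank (B n + t n *\<^sub>R E n) \<le> rank A"
    and t: "t \<longlonglongrightarrow> 0" "\<And>n. t n > 0" and E: "E \<longlonglongrightarrow> e"
  shows "e \<in> tangent_space A"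
  unfolding tangent_space_iff
proof (intro allI impI)
  fix u v assume u: "transpose A *v u = 0" and v: "A *v v = 0"
  have "(\<lambda>n. B n + t n *\<^sub>R E n) \<longlonglongrightarrow> A + 0 *\<^sub>R e"
    by (rule tendsto_add[OF B(1) tendsto_scaleR[OF t(1) E]])
  then have lim: "(\<lambda>n. B n + t n *\<^sub>R E n) \<longlonglongrightarrow> A" by simp
  obtain v' where v': "\<forall>\<^sub>F n in sequentially. (B n + t n *\<^sub>R E n) *v v' n = 0"
      "v' \<longlonglongrightarrow> v"
    by (rule kernel_lower_semicontinuous[OF lim C v])
  have rk: "rank (transpose (B n)) \<le> rank (transpose A)" for n
    unfolding rank_transpose by (rule B)
  obtain u' where u': "\<forall>\<^sub>F n in sequentially. transpose (B n) *v u' n = 0"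
      "u' \<longlonglongrightarrow> u"
    by (rule kernel_lower_semicontinuous[OF tendsto_transpose[OF B(1)] rk u])
  have "\<forall>\<^sub>F n in sequentially. u' n \<bullet> (E n *v v' n) = 0"
    using v'(1) u'(1)
  proof eventually_elim
    case (elim n)
    have "0 = u' n \<bullet> ((B n + t n *\<^sub>R E n) *v v' n)" using elim by simp
    also have "\<dots> = (transpose (B n) *v u' n) \<bullet> v' n + t n * (u' n \<bullet> (E n *v v' n))"
      by (simp add: matrix_vector_mult_add_rdistrib inner_right_distrib dot_lmul_matrix
          scaleR_matrix_vector_assoc[symmetric])
    also have "\<dots> = t n * (u' n \<bullet> (E n *v v' n))" using elim by simp
    finally show ?case using t(2)[of n] by simp
  qed
  then have "(\<lambda>n. u' n \<bullet> (E n *v v' n)) \<longlonglongrightarrow> 0"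
    by (rule tendsto_eventually)
  moreover have "(\<lambda>n. u' n \<bullet> (E n *v v' n)) \<longlonglongrightarrow> u \<bullet> (e *v v)"
    by (rule tendsto_inner[OF u'(2) tendsto_matrix_vector_mult[OF E v'(2)]])
  ultimately show "u \<bullet> (e *v v) = 0"
    by (rule LIMSEQ_unique[rotated])
qed

lemma zero_in_tangent_space: "0 \<in> tangent_space A"
  by (simp add: tangent_space_iff)

lemma rank_zero_le: "0 \<in> {C::real^'h^'p. rank C \<le> m}"
  by simp

text \<open>The upper bound moves \<open>B n\<close> along explicit curves that preserve the rank
  bound; the lower bound extracts, by compactness, a limit of the rescaled residuals at nearest
  points. The base point \<open>B n\<close> may vary, since the centre of the bootstrap varies with
  the sample size.\<close>

lemma infdist_rank_le_tendsto:
  fixes A :: "real^'h^'p"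
  assumes B: "B \<longlonglongrightarrow> A" "\<And>n. rank (B n) \<le> rank A"
    and t: "t \<longlonglongrightarrow> 0" "\<And>n. t n > 0"
  shows "(\<lambda>n. infdist (B n + t n *\<^sub>R w) {C. rank C \<le> rank A} / t n)
           \<longlonglongrightarrow> infdist w (tangent_space A)"
    (is "(\<lambda>n. infdist _ ?R / _) \<longlonglongrightarrow> ?L")
proof (rule order_tendstoI)
  fix a assume "?L < a"
  then obtain E where E: "E \<in> tangent_space A" "dist w E < a"
    using zero_in_tangent_space[of A] cINF_less_iff[of "tangent_space A" "dist w" a]
    by (metis bdd_belowI2 empty_iff infdist_notempty zero_le_dist)
  then obtain X Y where XY: "E = Y ** A + A ** X"
    by (auto simp: tangent_space_def)
  \<comment> \<open>\<open>D n\<close> is the difference quotient \<open>(C - B n) / t n\<close> for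
    \<open>C = (I + t n Y) B n (I + t n X)\<close>; it tends to \<open>E\<close>.\<close>
  define D where "D n = Y ** B n + B n ** X + t n *\<^sub>R (Y ** B n ** X)" for n
  have "D \<longlonglongrightarrow> Y ** A + A ** X + 0 *\<^sub>R (Y ** A ** X)"
    unfolding D_def by (intro tendsto_intros tendsto_matrix_mult B t)
  then have "(\<lambda>n. norm (w - D n)) \<longlonglongrightarrow> norm (w - E)"
    by (intro tendsto_intros) (simp add: XY)
  then have "\<forall>\<^sub>F n in sequentially. norm (w - D n) < a"
    using E by (intro order_tendstoD) (simp_all add: dist_norm)
  then show "\<forall>\<^sub>F n in sequentially. infdist (B n + t n *\<^sub>R w) ?R / t n < a"
  proof eventually_elim
    case (elim n)
    \<comment> \<open>a curve of matrices of rank at most \<open>rank (B n)\<close> with velocity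
        \<open>E\<close> in the limit\<close>
    let ?C = "(mat 1 + t n *\<^sub>R Y) ** B n ** (mat 1 + t n *\<^sub>R X)"
    have "rank ?C \<le> rank (B n)"
      by (meson rank_mul_le_left rank_mul_le_right order_trans)
    then have "infdist (B n + t n *\<^sub>R w) ?R \<le> dist (B n + t n *\<^sub>R w) ?C"
      using B(2)[of n] by (intro infdist_le) auto
    also have "?C = B n + t n *\<^sub>R D n"
      by (simp add: D_def matrix_eq matrix_vector_mul_assoc[symmetric] matrix_vector_mult_add_rdistrib
        matrix_vector_right_distrib scaleR_matrix_vector_assoc[symmetric]
        matrix_vector_mult_scaleR scaleR_right_distrib add_ac)
    also have "dist (B n + t n *\<^sub>R w) \<dots> = t n * norm (w - D n)"
      using t(2)[of n] by (simp add: dist_norm scaleR_diff_right[symmetric])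
    also have "\<dots> < t n * a" using elim t(2)[of n] by simp
    finally show ?case using t(2)[of n] by (simp add: field_simps)
  qed
next
  fix a assume a: "a < ?L"
  show "\<forall>\<^sub>F n in sequentially. a < infdist (B n + t n *\<^sub>R w) ?R / t n"
  proof (rule ccontr)
    assume "\<not> ?thesis"
    then have "\<exists>r. strict_mono (r :: nat \<Rightarrow> nat) \<and> (\<forall>n. \<not> a <
        infdist (B (r n) + t (r n) *\<^sub>R w) ?R / t (r n))"
      by (rule not_eventually_sequentiallyD)
    then obtain r :: "nat \<Rightarrow> nat" where r: "strict_mono r"
      "\<And>n. infdist (B (r n) + t (r n) *\<^sub>R w) ?R / t (r n) \<le> a"
      by (metis not_less)
    \<comment> \<open>\<open>D\<close> is the residual at a nearest matrix of the set, divided by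
      \<open>t n\<close>. Along \<open>r\<close> it stays in the ball of radius \<open>a\<close>,
      and for a limit point \<open>d\<close> the matrix \<open>w - d\<close> is tangent, hence
      \<open>?L \<le> norm d \<le> a\<close>.\<close>
    have "\<exists>D. rank (B n + t n *\<^sub>R (w - D)) \<le> rank A \<and>
          norm D = infdist (B n + t n *\<^sub>R w) ?R / t n" for n
    proof -
      obtain C where C: "C \<in> ?R" "infdist (B n + t n *\<^sub>R w) ?R = dist (B n + t n *\<^sub>R w) C"
        using infdist_attains_inf[OF closed_rank_le] rank_zero_le by blast
      define D where "D = (1 / t n) *\<^sub>R (B n + t n *\<^sub>R w - C)"
      have "B n + t n *\<^sub>R (w - D) = C"
        using t(2)[of n] by (simp add: D_def scaleR_diff_right)
      moreover have "norm D = dist (B n + t n *\<^sub>R w) C / t n"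
        using t(2)[of n] by (simp add: D_def dist_norm)
      ultimately show ?thesis using C by auto
    qed
    then obtain D where D: "\<And>n. rank (B n + t n *\<^sub>R (w - D n)) \<le> rank A"
      "\<And>n. norm (D n) = infdist (B n + t n *\<^sub>R w) ?R / t n"
      by metis
    have Da: "\<forall>n. (D \<circ> r) n \<in> cball 0 a"
      using D(2) r(2) by simp
    have "\<exists>d\<in>cball 0 a. \<exists>s. strict_mono s \<and> (D \<circ> r \<circ> s)
        \<longlonglongrightarrow> d"
      using compact_cball[of 0 a] Da unfolding compact_def by meson
    then obtain d s where d: "norm d \<le> a" "strict_mono s"
        "(D \<circ> r \<circ> s) \<longlonglongrightarrow> d"
      by auto
    have rs: "strict_mono (r \<circ> s)" using r(1) d(2) by (rule strict_mono_o)
    have "w - d \<in> tangent_space A"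
    proof (rule tangent_of_rank_bounded_sequences)
      show "(B \<circ> (r \<circ> s)) \<longlonglongrightarrow> A"
          "(t \<circ> (r \<circ> s)) \<longlonglongrightarrow> 0"
        using B(1) t(1) rs by (auto intro: LIMSEQ_subseq_LIMSEQ)
      show "(\<lambda>n. w - (D \<circ> r \<circ> s) n) \<longlonglongrightarrow> w - d"
        by (intro tendsto_intros d)
    qed (use B(2) t(2) D(1) in auto)
    then have "?L \<le> dist w (w - d)" by (rule infdist_le)
    with d(1) a show False by (simp add: dist_norm)
  qed
qed

section \<open>Singular value decompositions\<close>

definition orthonormal_on :: "'i set \<Rightarrow> ('i \<Rightarrow> 'a::real_inner) \<Rightarrow>
    bool" where
  "orthonormal_on I v \<longleftrightarrow> (\<forall>k\<in>I. \<forall>l\<in>I. v k \<bullet> v l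
      = (if k = l then 1 else 0))"

lemma norm_orthonormal_sum:
  assumes "finite I" "orthonormal_on I v"
  shows "(norm (\<Sum>k\<in>I. c k *\<^sub>R v k))\<^sup>2 = (\<Sum>k\<in>I. (c k)\<^sup>2)"
proof -
  have "(norm (\<Sum>k\<in>I. c k *\<^sub>R v k))\<^sup>2
      = (\<Sum>k\<in>I. \<Sum>l\<in>I. c k * (c l * (v k \<bullet> v l)))"
    by (simp add: power2_norm_eq_inner inner_sum_left inner_sum_right sum_distrib_left)
      (simp add: inner_commute)
  also have "\<dots> = (\<Sum>k\<in>I. \<Sum>l\<in>I. if k = l then (c k)\<^sup>2 else 0)"
    using assms(2) unfolding orthonormal_on_def
    by (intro sum.cong refl) (auto simp: power2_eq_square)
  finally show ?thesis
    using assms(1) by (simp add: sum.delta')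
qed

lemma norm_minus_orthonormal_projection:
  assumes "finite I" "orthonormal_on I v"
  shows "(norm (x - (\<Sum>k\<in>I. (v k \<bullet> x) *\<^sub>R v k)))\<^sup>2
      = (norm x)\<^sup>2 - (\<Sum>k\<in>I. (v k \<bullet> x)\<^sup>2)"
proof -
  let ?s = "\<Sum>k\<in>I. (v k \<bullet> x) *\<^sub>R v k"
  have "?s \<bullet> x = (\<Sum>k\<in>I. (v k \<bullet> x)\<^sup>2)"
    by (simp add: inner_sum_left power2_eq_square)
  moreover have "?s \<bullet> ?s = (\<Sum>k\<in>I. (v k \<bullet> x)\<^sup>2)"
    using norm_orthonormal_sum[OF assms] by (simp add: power2_norm_eq_inner)
  ultimately show ?thesis
    by (simp add: power2_norm_eq_inner inner_diff_left inner_diff_right inner_commute)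
qed

lemma bessel:
  assumes "finite I" "orthonormal_on I v"
  shows "(\<Sum>k\<in>I. (v k \<bullet> x)\<^sup>2) \<le> (norm x)\<^sup>2"
  using norm_minus_orthonormal_projection[OF assms, of x]
    zero_le_power2[of "norm (x - (\<Sum>k\<in>I. (v k \<bullet> x) *\<^sub>R v k))"] by linarith

text \<open>An orthonormal family with as many members as the dimension spans the space, so the
  residual of the expansion is orthogonal to itself.\<close>

lemma parseval:
  fixes v :: "'i \<Rightarrow> 'a::euclidean_space"
  assumes I: "finite I" "orthonormal_on I v" "card I = DIM('a)"
  shows "(\<Sum>k\<in>I. (v k \<bullet> x)\<^sup>2) = (norm x)\<^sup>2"
proof -
  have inj: "inj_on v I"
    using I(2) unfolding orthonormal_on_def by (intro inj_onI) (metis zero_neq_one)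
  have "0 \<notin> v ` I"
    using I(2) unfolding orthonormal_on_def by force
  moreover have "pairwise orthogonal (v ` I)"
    using I(2) unfolding orthonormal_on_def pairwise_def orthogonal_def by auto
  ultimately have "independent (v ` I)"
    by (intro pairwise_orthogonal_independent) auto
  then have "dim (v ` I) = DIM('a)"
    using inj I(3) by (simp add: dim_eq_card_independent card_image)
  then have span: "span (v ` I) = UNIV"
    by (simp add: dim_eq_full)
  define y where "y = x - (\<Sum>k\<in>I. (v k \<bullet> x) *\<^sub>R v k)"
  have "v l \<bullet> y = 0" if "l \<in> I" for l
  proof -
    have "v l \<bullet> (\<Sum>k\<in>I. (v k \<bullet> x) *\<^sub>R v k) = (\<Sum>k\<in>I. if l
        = k then v k \<bullet> x else 0)"
      unfolding inner_sum_right using I(2) that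
      by (intro sum.cong) (auto simp: orthonormal_on_def)
    then show ?thesis using that I(1) by (simp add: y_def inner_diff_right sum.delta)
  qed
  then have "orthogonal y z" if "z \<in> v ` I" for z
    using that by (auto simp: orthogonal_def inner_commute)
  then have "orthogonal y y"
    using orthogonal_to_span[of y "v ` I" y] span by auto
  then have "y = 0" by (simp add: orthogonal_def)
  then show ?thesis
    using norm_minus_orthonormal_projection[OF I(1,2), of x] by (simp add: y_def)
qed

section \<open>Rank one matrices\<close>

definition outer :: "real^'p \<Rightarrow> real^'h \<Rightarrow> real^'h^'p" where
  "outer x y = (\<chi> i j. x $ i * y $ j)"

text \<open>The inner product of matrices is the Frobenius one. Pairing two orthonormal families
  therefore gives orthonormal rank one matrices, which makes singular value expansions
  Pythagorean.\<close>

lemma inner_outer: "outer x y \<bullet> outer x' y' = (x \<bullet> x') * (y \<bullet> y')"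
  by (simp add: outer_def inner_vec_def sum_product algebra_simps) (rule sum.swap)

lemma outer_mult_vector: "outer x y *v z = (y \<bullet> z) *\<^sub>R x"
  by (simp add: outer_def vec_eq_iff matrix_vector_mult_def inner_vec_def sum_distrib_right
      sum_distrib_left ac_simps)

lemma transpose_outer: "transpose (outer x y) = outer y x"
  by (simp add: outer_def transpose_def vec_eq_iff)

lemma matrix_mult_sum_left: "(\<Sum>k\<in>I. A k) ** B = (\<Sum>k\<in>I. A k ** (B::real^'k^'h))"
  by (simp add: vec_eq_iff matrix_matrix_mult_def sum_distrib_right) (auto intro: sum.swap)

lemma matrix_mult_sum_right: "B ** (\<Sum>k\<in>I. A k) = (\<Sum>k\<in>I. (B::real^'k^'h) ** A k)"
  by (simp add: vec_eq_iff matrix_matrix_mult_def sum_distrib_left) (auto intro: sum.swap)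

lemma matrix_sum_mult_vector: "(\<Sum>k\<in>I. A k) *v x = (\<Sum>k\<in>I. (A k :: real^'k^'h) *v x)"
  by (simp add: vec_eq_iff matrix_vector_mult_def sum_distrib_right) (auto intro: sum.swap)

lemma transpose_sum: "transpose (\<Sum>k\<in>I. A k) = (\<Sum>k\<in>I. transpose (A k))"
  by (simp add: vec_eq_iff transpose_def)

lemma transpose_scaleR: "transpose (c *\<^sub>R A) = c *\<^sub>R transpose (A::real^'h^'p)"
  by (simp add: vec_eq_iff transpose_def)

lemma matrix_mult_outer_mult:
  "P ** outer x y ** Q = outer (P *v x) (transpose Q *v y)"
proof -
  have "(P ** outer x y ** Q) *v z = outer (P *v x) (transpose Q *v y) *v z" for z
    by (simp add: matrix_vector_mul_assoc[symmetric] outer_mult_vector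
        matrix_vector_mult_scaleR dot_lmul_matrix)
  then show ?thesis by (simp add: matrix_eq)
qed

lemma rank_outer_sum_le:
  assumes "finite I"
  shows "rank (\<Sum>k\<in>I. c k *\<^sub>R outer (u k) (v k)) \<le> card I"
proof -
  have "range ((*v) (\<Sum>k\<in>I. c k *\<^sub>R outer (u k) (v k))) \<subseteq> span (u ` I)"
    unfolding matrix_sum_mult_vector scaleR_matrix_vector_assoc[symmetric] outer_mult_vector
    by (intro image_subsetI span_sum span_scale span_base imageI)
  then have "rank (\<Sum>k\<in>I. c k *\<^sub>R outer (u k) (v k)) \<le> dim (span (u ` I))"
    unfolding rank_dim_range by (rule dim_subset)
  also have "\<dots> \<le> card I"
    by (metis assms card_image_le dim_le_card' dim_span finite_imageI order_trans)
  finally show ?thesis .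
qed

lemma norm_transpose: "norm (transpose A) = norm (A::real^'h^'p)"
  unfolding norm_eq_sqrt_inner inner_vec_def transpose_def by simp (rule sum.swap)

text \<open>Bessel's inequality for each row of \<open>D\<close>, summed over the rows.\<close>

lemma bessel_matrix:
  fixes D :: "real^'h^'p"
  assumes "finite I" "orthonormal_on I f"
  shows "(\<Sum>k\<in>I. (norm (D *v f k))\<^sup>2) \<le> (norm D)\<^sup>2"
proof -
  have "(\<Sum>k\<in>I. (norm (D *v f k))\<^sup>2)
      = (\<Sum>i\<in>UNIV. \<Sum>k\<in>I. (f k \<bullet> D $ i)\<^sup>2)"
    by (simp only: power2_norm_eq_inner inner_vec_def[of "D *v _"] inner_real_def
        matrix_vector_mul_component power2_eq_square[symmetric] inner_commute[of "f _"])
      (rule sum.swap)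
  also have "\<dots> \<le> (\<Sum>i\<in>UNIV. (norm (D $ i))\<^sup>2)"
    by (intro sum_mono bessel assms)
  also have "\<dots> = (norm D)\<^sup>2"
    by (simp add: power2_norm_eq_inner inner_vec_def[of D])
  finally show ?thesis .
qed

section \<open>The Eckart-Young theorem\<close>

lemma is_svdD:
  fixes A :: "real^'h^'p"
  assumes "is_svd A s u v"
  shows "A = (\<Sum>k=1..CARD('p). s k *\<^sub>R outer (u k) (v k))"
    "orthonormal_on {1..CARD('p)} u" "orthonormal_on {1..CARD('p)} v"
    "\<And>k. k \<in> {1..CARD('p)} \<Longrightarrow> 0 \<le> s k"
    "\<And>k l. k \<in> {1..CARD('p)} \<Longrightarrow> l \<in> {1..CARD('p)}
        \<Longrightarrow> k \<le> l \<Longrightarrow> s l \<le> s k"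
  using assms unfolding is_svd_def orthonormal_on_def outer_def by blast+

text \<open>After removal of the leading terms a combination of orthonormal rank one matrices
  remains.\<close>

lemma svd_truncation_norm:
  fixes A :: "real^'h^'p"
  assumes svd: "is_svd A s u v" and m: "m \<le> CARD('p)"
  shows "(norm (A - (\<Sum>k=1..m. s k *\<^sub>R outer (u k) (v k))))\<^sup>2
      = (\<Sum>k=m+1..CARD('p). (s k)\<^sup>2)"
proof -
  have "{1..CARD('p)} = {1..m} \<union> {m+1..CARD('p)}" using m by auto
  then have "A = (\<Sum>k=1..m. s k *\<^sub>R outer (u k) (v k)) + (\<Sum>k=m+1..CARD('p). s k
      *\<^sub>R outer (u k) (v k))"
    unfolding is_svdD(1)[OF svd] by (simp only:) (rule sum.union_disjoint, auto)
  moreover have "orthonormal_on {m+1..CARD('p)} (\<lambda>k. outer (u k) (v k))"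
    using is_svdD(2,3)[OF svd] by (auto simp: orthonormal_on_def inner_outer)
  ultimately show ?thesis
    using norm_orthonormal_sum[of "{m+1..CARD('p)}" "\<lambda>k. outer (u k) (v k)" s] by simp
qed

text \<open>An orthonormal basis of the orthogonal complement of the row space, which lies in the
  kernel.\<close>

lemma orthonormal_family_in_kernel:
  fixes C :: "real^'h^'p"
  obtains F where "finite F" "card F = CARD('h) - rank C" "orthonormal_on F (\<lambda>x. x)"
    "\<And>x. x \<in> F \<Longrightarrow> C *v x = 0"
proof -
  let ?K = "{y. \<forall>x\<in>span (rows C). orthogonal x y}"
  have K: "subspace ?K"
    by (auto simp: subspace_def orthogonal_clauses)
  obtain F where F: "F \<subseteq> ?K" "pairwise orthogonal F"
      "\<And>x. x \<in> F \<Longrightarrow> norm x = 1"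
    "independent F" "card F = dim ?K" "span F = ?K"
    by (rule orthonormal_basis_subspace[OF K]) (rule that)
  have "dim ?K + rank C = CARD('h)"
    using dim_subspace_orthogonal_to_vectors[of "span (rows C)" UNIV, OF subspace_span subspace_UNIV]
    by (simp only: row_rank_def dim_span UNIV_I simp_thms subset_UNIV dim_UNIV) (simp only:
        DIM_cart DIM_real mult_1_right)
  moreover have "C *v x = 0" if "x \<in> F" for x
  proof -
    have "row i C \<bullet> x = 0" for i
      using that F(1) span_base[of "row i C" "rows C"] by (auto simp: rows_def orthogonal_def)
    then show ?thesis by (simp add: vec_eq_iff matrix_vector_mul_component row_def)
  qed
  moreover have "orthonormal_on F (\<lambda>x. x)"
    using F(2,3) by (auto simp: orthonormal_on_def pairwise_def orthogonal_def norm_eq_1)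
  moreover have "finite F" using F(4) by (rule independent_imp_finite)
  ultimately show ?thesis using that[of F] F(5) by simp
qed

text \<open>On an orthonormal basis \<open>F\<close> of the left kernel of \<open>C\<close> the
  transposes of \<open>A\<close> and \<open>A - C\<close> agree, so Bessel bounds the squared norm
  of \<open>A - C\<close> from below by a weighted sum of the \<open>(s k)^2\<close>. The weights
  lie in \<open>[0, 1]\<close> and have total at least \<open>p - m\<close>; as \<open>s\<close>
  decreases, such a sum is smallest when the weight sits on the tail.\<close>

lemma svd_tail_le:
  fixes A C :: "real^'h^'p"
  assumes svd: "is_svd A s u v" and m: "m \<in> {1..CARD('p)}" and C: "rank C \<le> m"
  shows "(\<Sum>k=m+1..CARD('p). (s k)\<^sup>2) \<le> (norm (A - C))\<^sup>2"
proof -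
  let ?I = "{1..CARD('p)}"
  note svdD = is_svdD[OF svd]
  obtain F where F: "finite F" "card F = CARD('p) - rank C" "orthonormal_on F (\<lambda>x. x)"
    and CF: "\<And>x. x \<in> F \<Longrightarrow> transpose C *v x = 0"
    using orthonormal_family_in_kernel[of "transpose C"] by (metis rank_transpose)
  \<comment> \<open>\<open>c k\<close> is the squared length of the projection of \<open>u k\<close>
    onto the span of \<open>F\<close>.\<close>
  define c where "c k = (\<Sum>f\<in>F. (f \<bullet> u k)\<^sup>2)" for k
  have c1: "c k \<le> 1" if "k \<in> ?I" for k
    using bessel[OF F(1,3), of "u k"] svdD(2) that
    by (simp add: c_def orthonormal_on_def power2_norm_eq_inner)
  have c0: "c k \<ge> 0" for k unfolding c_def by (intro sum_nonneg) simp
  \<comment> \<open>The \<open>p\<close> vectors \<open>u k\<close> form an orthonormal basis, so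
    each unit vector \<open>f\<close> contributes exactly 1 to the total weight.\<close>
  have "(\<Sum>k\<in>?I. c k) = (\<Sum>f\<in>F. \<Sum>k\<in>?I. (u k \<bullet> f)\<^sup>2)"
    unfolding c_def by (subst sum.swap) (simp add: inner_commute)
  also have "\<dots> = (\<Sum>f\<in>F. (norm f)\<^sup>2)"
    by (intro sum.cong refl parseval svdD) auto
  also have "\<dots> = card F"
    using F(3) by (simp add: orthonormal_on_def power2_norm_eq_inner)
  finally have csum: "(\<Sum>k\<in>?I. c k) \<ge> real (CARD('p) - m)"
    using F(2) C by simp
  have At: "transpose A *v f = (\<Sum>k\<in>?I. (s k * (u k \<bullet> f)) *\<^sub>R v k)" for f
    by (subst svdD(1)) (simp add: transpose_sum transpose_scaleR transpose_outer
      matrix_sum_mult_vector scaleR_matrix_vector_assoc[symmetric] outer_mult_vector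
      del: transpose_matrix_vector)
  have "(\<Sum>k\<in>?I. (s k)\<^sup>2 * c k)
      = (\<Sum>f\<in>F. \<Sum>k\<in>?I. (s k * (u k \<bullet> f))\<^sup>2)"
    unfolding c_def sum_distrib_left by (subst sum.swap) (simp add: inner_commute power_mult_distrib)
  also have "\<dots> = (\<Sum>f\<in>F. (norm (transpose A *v f))\<^sup>2)"
    unfolding At by (intro sum.cong refl norm_orthonormal_sum[symmetric] svdD) auto
  also have "\<dots> = (\<Sum>f\<in>F. (norm (transpose (A - C) *v f))\<^sup>2)"
  proof (rule sum.cong)
    fix f assume "f \<in> F"
    have "transpose (A - C) *v f = transpose A *v f - transpose C *v f"
      by (simp add: vector_matrix_mult_diff_rdistrib)
    then show "(norm (transpose A *v f))\<^sup>2 = (norm (transpose (A - C) *v f))\<^sup>2"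
      using CF[OF \<open>f \<in> F\<close>] by simp
  qed simp
  also have "\<dots> \<le> (norm (transpose (A - C)))\<^sup>2"
    by (rule bessel_matrix[OF F(1,3)])
  finally have le: "(\<Sum>k\<in>?I. (s k)\<^sup>2 * c k) \<le> (norm (A - C))\<^sup>2"
    by (simp add: norm_transpose)
  let ?J = "{m+1..CARD('p)}"
  have I: "?I = {1..m} \<union> ?J" using m by auto
  have split: "(\<Sum>k\<in>?I. g k) = (\<Sum>k=1..m. g k) + (\<Sum>k\<in>?J. g k)" for g :: "nat
      \<Rightarrow> real"
    unfolding I by (rule sum.union_disjoint) auto
  \<comment> \<open>Weight missing in the tail costs at most \<open>(s m)^2\<close> per unit. It is
    compensated by the weight on the first \<open>m\<close> indices, where each unit gains at least
    \<open>(s m)^2\<close>.\<close>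
  have "(\<Sum>k\<in>?J. (s k)\<^sup>2 * (1 - c k)) \<le> (\<Sum>k\<in>?J. (s m)\<^sup>2 * (1 - c k))"
    using svdD(4,5) m c1 by (intro sum_mono mult_right_mono power_mono) auto
  also have "\<dots> = (s m)\<^sup>2 * (real (CARD('p) - m) - (\<Sum>k\<in>?J. c k))"
    by (simp add: sum_distrib_left[symmetric] sum_subtractf)
  also have "\<dots> \<le> (s m)\<^sup>2 * (\<Sum>k=1..m. c k)"
    using csum split[of c] by (intro mult_left_mono) auto
  also have "\<dots> \<le> (\<Sum>k=1..m. (s k)\<^sup>2 * c k)"
    unfolding sum_distrib_left
    using svdD(4,5) m c0 by (intro sum_mono mult_right_mono power_mono) auto
  finally show ?thesis
    using le split[of "\<lambda>k. (s k)\<^sup>2 * c k"] by (simp add: right_diff_distrib sum_subtractf)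
qed

lemma svd_truncation_rank:
  fixes u :: "nat \<Rightarrow> real^'p" and v :: "nat \<Rightarrow> real^'h"
  shows "rank (\<Sum>k=1..m. s k *\<^sub>R outer (u k) (v k)) \<le> m"
  using rank_outer_sum_le[of "{1..m}" s u v] by simp

text \<open>The truncated expansion is a competitor of rank at most \<open>m\<close>, and
  \<open>svd_tail_le\<close> applied to a nearest matrix shows that no competitor is closer.\<close>

lemma svd_truncation_dist:
  fixes A :: "real^'h^'p"
  assumes svd: "is_svd A s u v" and m: "m \<in> {1..CARD('p)}"
  shows "norm (A - (\<Sum>k=1..m. s k *\<^sub>R outer (u k) (v k))) = infdist A {C. rank C \<le> m}"
    (is "norm (A - ?T) = infdist A ?R")
proof (rule antisym)
  obtain C where C: "C \<in> ?R" "infdist A ?R = dist A C"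
    using infdist_attains_inf[OF closed_rank_le] rank_zero_le by blast
  have "(norm (A - ?T))\<^sup>2 \<le> (norm (A - C))\<^sup>2"
    using svd_tail_le[OF svd m, of C] svd_truncation_norm[OF svd, of m] m C by simp
  then show "norm (A - ?T) \<le> infdist A ?R"
    using C by (simp add: dist_norm power2_le_iff_abs_le)
  show "infdist A ?R \<le> norm (A - ?T)"
    using infdist_le[of ?T ?R A] svd_truncation_rank[of s u v m] by (simp add: dist_norm)
qed

text \<open>This turns the test statistics into distances, whichever decomposition the singular
  values come from.\<close>

lemma singular_values_tail_eq_infdist:
  fixes A :: "real^'h^'p"
  assumes "are_singular_values A s" "m \<in> {1..CARD('p)}"
  shows "(\<Sum>k=m+1..CARD('p). (s k)\<^sup>2) = (infdist A {C. rank C \<le> m})\<^sup>2"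
proof -
  obtain u v where svd: "is_svd A s u v"
    using assms(1) unfolding are_singular_values_def by blast
  show ?thesis
    using svd_truncation_norm[OF svd, of m] svd_truncation_dist[OF svd assms(2)] assms(2) by simp
qed

section \<open>Projectors onto leading singular vectors\<close>

lemma orth_projector_fixes:
  assumes "is_orth_projector P S" "x \<in> S"
  shows "P *v x = x"
  using assms unfolding is_orth_projector_def
  by (metis imageE matrix_vector_mul_assoc)

text \<open>As \<open>P\<close> is symmetric and idempotent, the squared norm of
  \<open>P *v x\<close> equals \<open>x \<bullet> (P *v x)\<close>, and \<open>P *v x\<close> lies
  in \<open>S\<close>.\<close>

lemma orth_projector_orthogonal:
  assumes P: "is_orth_projector P S" and x: "\<And>y. y \<in> S \<Longrightarrow> x \<bullet> y = 0"
  shows "P *v x = 0"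
proof -
  have "(P *v x) \<bullet> (P *v x) = x \<bullet> (transpose P *v (P *v x))"
    by (metis dot_lmul_matrix transpose_matrix_vector transpose_transpose)
  also have "\<dots> = x \<bullet> (P *v x)"
    using P by (simp add: is_orth_projector_def matrix_vector_mul_assoc del: transpose_matrix_vector)
  also have "\<dots> = 0"
    using P x unfolding is_orth_projector_def by blast
  finally show ?thesis by simp
qed

lemma leading_projector_singular_vectors:
  fixes u :: "nat \<Rightarrow> real^'n"
  assumes P: "is_orth_projector P (span (u ` {1..m}))" and u: "orthonormal_on {1..n} u" "m
      \<le> n" "k \<in> {1..n}"
  shows "P *v u k = (if k \<le> m then u k else 0)"
proof (cases "k \<le> m")
  case True
  then show ?thesis using u(3) by (auto intro!: orth_projector_fixes[OF P] span_base)
next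
  case False
  have "u k \<bullet> u l = 0" if "l \<in> {1..m}" for l
  proof -
    from that u(2) have "l \<in> {1..n}" by auto
    with False u(1,3) that show ?thesis unfolding orthonormal_on_def by auto
  qed
  then have uk: "orthogonal (u k) z" if "z \<in> u ` {1..m}" for z
    using that by (auto simp: orthogonal_def)
  have "orthogonal (u k) y" if "y \<in> span (u ` {1..m})" for y
    using that uk by (rule orthogonal_to_span)
  then show ?thesis
    using False orth_projector_orthogonal[OF P, of "u k"] by (simp add: orthogonal_def)
qed

text \<open>Both projectors come from one decomposition, so they keep the terms with index at most
  \<open>m\<close> and annihilate the others: \<open>P1 ** A ** P2\<close> is the truncated
  expansion.\<close>

lemma leading_projectors_truncate:
  fixes A :: "real^'h^'p"
  assumes "are_leading_projectors m A P1 P2" and m: "m \<in> {1..CARD('p)}"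
  shows "rank (P1 ** A ** P2) \<le> m" "norm (A - P1 ** A ** P2) = infdist A {C. rank C \<le> m}"
proof -
  obtain s u v where svd: "is_svd A s u v"
    and P: "is_orth_projector P1 (span (u ` {1..m}))" "is_orth_projector P2 (span (v ` {1..m}))"
    using assms(1) unfolding are_leading_projectors_def by blast
  note svdD = is_svdD[OF svd]
  have "P1 ** A ** P2 = (\<Sum>k=1..CARD('p). P1 ** (s k *\<^sub>R outer (u k) (v k)) ** P2)"
    by (subst svdD(1)) (simp add: matrix_mult_sum_left matrix_mult_sum_right)
  also have "\<dots> = (\<Sum>k=1..CARD('p). s k *\<^sub>R (P1 ** outer (u k) (v k) ** P2))"
    by (simp add: vec_eq_iff matrix_matrix_mult_def sum_distrib_left sum_distrib_right mult.assoc
        mult.left_commute)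
  also have "\<dots> = (\<Sum>k=1..CARD('p). s k *\<^sub>R outer (P1 *v u k) (P2 *v v k))"
    using P(2) unfolding matrix_mult_outer_mult is_orth_projector_def by simp
  also have "\<dots> = (\<Sum>k=1..m. s k *\<^sub>R outer (u k) (v k))"
    using m by (intro sum.mono_neutral_cong_right)
      (auto simp: leading_projector_singular_vectors[OF P(1) svdD(2)]
         leading_projector_singular_vectors[OF P(2) svdD(3)] outer_def vec_eq_iff)
  finally have *: "P1 ** A ** P2 = (\<Sum>k=1..m. s k *\<^sub>R outer (u k) (v k))" .
  show "rank (P1 ** A ** P2) \<le> m"
    unfolding * by (rule svd_truncation_rank)
  show "norm (A - P1 ** A ** P2) = infdist A {C. rank C \<le> m}"
    unfolding * by (rule svd_truncation_dist[OF svd m])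
qed

section \<open>Squared norms of Gaussian vectors\<close>

text \<open>The explicit Lebesgue density makes Lebesgue null sets null for this law, and its
  product form makes the characteristic function factor.\<close>

definition std_gauss :: "'a::euclidean_space measure" where
  "std_gauss = density lborel (\<lambda>z. ennreal (\<Prod>b\<in>Basis. std_normal_density (z
      \<bullet> b)))"

lemma sets_std_gauss [simp, measurable_cong]: "sets std_gauss = sets borel"
  by (simp add: std_gauss_def)

lemma prob_space_std_gauss: "prob_space std_gauss"
proof
  have 1: "(\<integral>\<^sup>+x. ennreal (std_normal_density x) \<partial>lborel) = 1"
    using prob_space.emeasure_space_1[OF prob_space_normal_density[of 1 0]]
    by (simp add: emeasure_density)
  have "emeasure (std_gauss :: 'a measure) (space std_gauss)
      = (\<integral>\<^sup>+z. (\<Prod>b\<in>Basis. ennreal (std_normal_density (z \<bullet> b)))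
          \<partial>(lborel :: 'a measure))"
    by (simp add: std_gauss_def emeasure_density prod_ennreal)
  also have "\<dots> = (\<Prod>b\<in>(Basis::'a set). (\<integral>\<^sup>+x. ennreal
      (std_normal_density x) \<partial>lborel))"
    by (rule nn_integral_lborel_prod) auto
  finally show "emeasure (std_gauss :: 'a measure) (space std_gauss) = 1"
    by (simp add: 1)
qed

lemma integral_std_normal_iexp:
  "integrable lborel (\<lambda>x. std_normal_density x *\<^sub>R iexp (t * x))"
  "(CLINT x|lborel. std_normal_density x *\<^sub>R iexp (t * x))
      = complex_of_real (exp (- (t\<^sup>2) / 2))"
proof -
  interpret prob_space "density lborel (\<lambda>x. ennreal (std_normal_density x))"
    by (rule prob_space_normal_density) simp
  have "integrable (density lborel (\<lambda>x. ennreal (std_normal_density x))) (\<lambda>x. iexp (t * x))"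
    by (rule integrable_const_bound[of _ 1]) auto
  then show "integrable lborel (\<lambda>x. std_normal_density x *\<^sub>R iexp (t * x))"
    by (subst (asm) integrable_density) auto
  have "(CLINT x|lborel. std_normal_density x *\<^sub>R iexp (t * x)) = char std_normal_distribution t"
    unfolding char_def by (subst integral_density) auto
  then show "(CLINT x|lborel. std_normal_density x *\<^sub>R iexp (t * x))
      = complex_of_real (exp (- (t\<^sup>2) / 2))"
    by (simp add: char_std_normal_distribution)
qed

text \<open>Lebesgue measure is the image of the product measure over the coordinates; density and
  exponential both factor, which reduces the claim to one dimension.\<close>

lemma char_std_gauss:
  fixes y :: "'a::euclidean_space"
  shows "(CLINT z|std_gauss. iexp (z \<bullet> y)) = complex_of_real (exp (- (norm y)\<^sup>2 / 2))"
proof -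
  interpret product_sigma_finite "\<lambda>b::'a. lborel :: real measure" ..
  let ?g = "\<lambda>z::'a. \<Prod>b\<in>Basis. std_normal_density (z \<bullet> b)"
  let ?h = "\<lambda>b t. std_normal_density t *\<^sub>R iexp ((y \<bullet> b) * t)"
  let ?T = "\<lambda>f::'a \<Rightarrow> real. \<Sum>b\<in>Basis. f b *\<^sub>R b"
  have "(CLINT z|std_gauss. iexp (z \<bullet> y)) = (CLINT z|lborel. ?g z *\<^sub>R iexp (z \<bullet> y))"
    unfolding std_gauss_def by (rule integral_density) (auto intro!: AE_I2 prod_nonneg)
  also have "\<dots> = (CLINT f|(\<Pi>\<^sub>M b\<in>Basis. lborel). ?g (?T f) *\<^sub>R iexp (?T f
      \<bullet> y))"
    by (subst lborel_eq, subst integral_distr) auto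
  also have "\<dots> = (CLINT f|(\<Pi>\<^sub>M b\<in>Basis. lborel). \<Prod>b\<in>Basis. ?h b (f b))"
  proof (rule Bochner_Integration.integral_cong[OF refl])
    fix f :: "'a \<Rightarrow> real"
    have "iexp (?T f \<bullet> y) = (\<Prod>b\<in>Basis. iexp ((y \<bullet> b) * f b))"
    proof -
      have "?T f \<bullet> y = (\<Sum>b\<in>Basis. (y \<bullet> b) * f b)"
        by (simp add: inner_sum_left inner_commute[of y] mult.commute)
      then show ?thesis by (simp only: of_real_sum sum_distrib_left exp_sum finite_Basis)
    qed
    then show "?g (?T f) *\<^sub>R iexp (?T f \<bullet> y) = (\<Prod>b\<in>Basis. ?h b (f b))"
      by (simp add: scaleR_conv_of_real prod.distrib)
  qed
  also have "\<dots> = (\<Prod>b\<in>Basis. (CLINT t|lborel. ?h b t))"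
    by (intro product_integral_prod finite_Basis integral_std_normal_iexp)
  also have "\<dots> = (\<Prod>b\<in>Basis. complex_of_real (exp (- ((y \<bullet> b)\<^sup>2) / 2)))"
    unfolding integral_std_normal_iexp ..
  also have "\<dots> = complex_of_real (exp (\<Sum>b\<in>Basis. - ((y \<bullet> b)\<^sup>2) / 2))"
    by (simp add: exp_sum)
  also have "(\<Sum>b\<in>Basis. - ((y \<bullet> b)\<^sup>2) / 2) = - (norm y)\<^sup>2 / 2"
  proof -
    have "(norm y)\<^sup>2 = (\<Sum>b\<in>Basis. (y \<bullet> b)\<^sup>2)"
      unfolding power2_norm_eq_inner by (subst euclidean_inner) (simp add: power2_eq_square)
    then show ?thesis by (simp add: sum_divide_distrib[symmetric] sum_negf)
  qed
  finally show ?thesis .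
qed

lemma std_gauss_null:
  assumes "negligible S" "S \<in> sets borel"
  shows "measure (std_gauss :: 'a::euclidean_space measure) S = 0"
proof -
  have "S \<in> null_sets (lborel :: 'a measure)"
    using assms by (simp add: negligible_iff_null_sets null_sets_completion_iff)
  moreover have "absolutely_continuous lborel (std_gauss :: 'a measure)"
    unfolding std_gauss_def by (rule absolutely_continuousI_density) simp
  ultimately have "S \<in> null_sets std_gauss"
    unfolding absolutely_continuous_def by blast
  then show ?thesis by (simp add: measure_eq_0_null_sets)
qed

text \<open>The factor \<open>exp (- s |x|^2)\<close> is the characteristic function of a standard
  Gaussian \<open>Z\<close> at \<open>sqrt (2 s) x\<close>. Fubini exchanges the two integrals, and
  the inner one becomes the characteristic function of \<open>\<mu>\<close> at
  \<open>sqrt (2 s) Z\<close>.\<close>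

lemma gaussian_laplace_norm:
  fixes \<mu> :: "'a::euclidean_space measure"
  assumes \<mu>: "prob_space \<mu>" "sets \<mu> = sets borel"
    and char: "\<And>a. (CLINT x|\<mu>. iexp (a \<bullet> x)) = complex_of_real (exp (- q a / 2))"
    and hom: "\<And>r a. q (r *\<^sub>R a) = r\<^sup>2 * q a" and s: "s \<ge> 0"
  shows "(\<integral>x. exp (- s * (norm x)\<^sup>2) \<partial>\<mu>)
      = (\<integral>z. exp (- s * q z) \<partial>std_gauss)"
proof -
  interpret \<mu>: prob_space \<mu> by fact
  interpret g: prob_space "std_gauss :: 'a measure" by (rule prob_space_std_gauss)
  interpret P: pair_prob_space "std_gauss :: 'a measure" \<mu> ..
  note [measurable_cong] = \<mu>(2)
  let ?r = "sqrt (2 * s)"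
  have r: "?r\<^sup>2 = 2 * s" using s by simp
  have int: "integrable (std_gauss \<Otimes>\<^sub>M \<mu>) (\<lambda>(z, x). iexp (z \<bullet> (?r
      *\<^sub>R x)))"
    by (rule P.P.integrable_const_bound[of _ 1]) (auto simp: split_beta)
  have "complex_of_real (\<integral>x. exp (- s * (norm x)\<^sup>2) \<partial>\<mu>)
      = (CLINT x|\<mu>. complex_of_real (exp (- s * (norm x)\<^sup>2)))"
    by (rule integral_complex_of_real[symmetric])
  also have "\<dots> = (CLINT x|\<mu>. CLINT z|std_gauss. iexp (z \<bullet> (?r *\<^sub>R x)))"
    unfolding char_std_gauss using r by (simp add: power_mult_distrib)
  also have "\<dots> = (CLINT z|std_gauss. CLINT x|\<mu>. iexp (z \<bullet> (?r *\<^sub>R x)))"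
    by (rule P.Fubini_integral[OF int])
  also have "\<dots> = (CLINT z|std_gauss. CLINT x|\<mu>. iexp ((?r *\<^sub>R z) \<bullet> x))"
    by simp
  also have "\<dots> = (CLINT z|std_gauss. complex_of_real (exp (- s * q z)))"
    unfolding char hom r by simp
  also have "\<dots> = complex_of_real (\<integral>z. exp (- s * q z) \<partial>std_gauss)"
    by (rule integral_complex_of_real)
  finally show ?thesis by (simp only: of_real_eq_iff)
qed

text \<open>By Weierstrass a continuous function is uniformly approximated on the unit interval by
  polynomials, whose integrals are determined by the moments.\<close>

lemma integral_eq_if_moments_eq:
  fixes f :: "real \<Rightarrow> real" and X :: "'a \<Rightarrow> real" and Y :: "'b \<Rightarrow> real"
  assumes M: "prob_space M" "X \<in> borel_measurable M" "\<And>x. X x \<in> {0..1}"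
    and N: "prob_space N" "Y \<in> borel_measurable N" "\<And>x. Y x \<in> {0..1}"
    and moments: "\<And>k::nat. (\<integral>x. X x ^ k \<partial>M) = (\<integral>x. Y x ^ k \<partial>N)"
    and f: "continuous_on UNIV f"
  shows "(\<integral>x. f (X x) \<partial>M) = (\<integral>x. f (Y x) \<partial>N)"
proof -
  interpret M: prob_space M by fact
  interpret N: prob_space N by fact
  note [measurable] = M(2) N(2) borel_measurable_continuous_onI[OF f]
  have "bounded (f ` {0..1})"
    by (intro compact_imp_bounded compact_continuous_image continuous_on_subset[OF f]) auto
  then obtain B where B: "\<And>x. x \<in> {0..1} \<Longrightarrow> norm (f x) \<le> B"
    unfolding bounded_iff by blast
  have fM: "integrable M (\<lambda>x. f (X x))"
    by (rule M.integrable_const_bound[of _ B]) (use M(3) B in auto)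
  have fN: "integrable N (\<lambda>x. f (Y x))"
    by (rule N.integrable_const_bound[of _ B]) (use N(3) B in auto)
  have pM: "integrable M (\<lambda>x. X x ^ k)" for k
    by (rule M.integrable_const_bound[of _ 1]) (use M(3) in \<open>auto intro!: power_le_one\<close>)
  have pN: "integrable N (\<lambda>x. Y x ^ k)" for k
    by (rule N.integrable_const_bound[of _ 1]) (use N(3) in \<open>auto intro!: power_le_one\<close>)
  have "\<bar>(\<integral>x. f (X x) \<partial>M) - (\<integral>x. f (Y x) \<partial>N)\<bar>
      \<le> e" if e: "e > 0" for e
  proof -
    obtain g where g: "real_polynomial_function g" "\<And>x. x \<in> {0..1}
        \<Longrightarrow> \<bar>f x - g x\<bar> < e / 2"
      using Stone_Weierstrass_real_polynomial_function[OF compact_Icc continuous_on_subset[OF f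
          subset_UNIV]]
        half_gt_zero[OF e] by metis
    obtain a n where a: "g = (\<lambda>x. \<Sum>i\<le>n. a i * x ^ i)"
      using g(1) by (auto simp: real_polynomial_function_iff_sum)
    have gM: "integrable M (\<lambda>x. g (X x))"
      unfolding a by (intro Bochner_Integration.integrable_sum integrable_mult_right pM)
    have gN: "integrable N (\<lambda>x. g (Y x))"
      unfolding a by (intro Bochner_Integration.integrable_sum integrable_mult_right pN)
    have eq: "(\<integral>x. g (X x) \<partial>M) = (\<integral>x. g (Y x) \<partial>N)"
      unfolding a by (simp add: pM pN moments)
    have "\<bar>(\<integral>x. f (X x) \<partial>M) - (\<integral>x. g (X x) \<partial>M)\<bar>
        \<le> (\<integral>x. \<bar>f (X x) - g (X x)\<bar> \<partial>M)"
      using fM gM by (simp add: integral_abs_bound flip: Bochner_Integration.integral_diff)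
    also have "\<dots> \<le> (\<integral>x. e / 2 \<partial>M)"
      using fM gM g(2) M(3) by (intro integral_mono) (auto intro: less_imp_le)
    finally have 1: "\<bar>(\<integral>x. f (X x) \<partial>M) - (\<integral>x. g (X x)
        \<partial>M)\<bar> \<le> e / 2" by (simp add: M.prob_space)
    have "\<bar>(\<integral>x. f (Y x) \<partial>N) - (\<integral>x. g (Y x) \<partial>N)\<bar>
        \<le> (\<integral>x. \<bar>f (Y x) - g (Y x)\<bar> \<partial>N)"
      using fN gN by (simp add: integral_abs_bound flip: Bochner_Integration.integral_diff)
    also have "\<dots> \<le> (\<integral>x. e / 2 \<partial>N)"
      using fN gN g(2) N(3) by (intro integral_mono) (auto intro: less_imp_le)
    finally have "\<bar>(\<integral>x. f (Y x) \<partial>N) - (\<integral>x. g (Y x)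
        \<partial>N)\<bar> \<le> e / 2" by (simp add: N.prob_space)
    with 1 eq show ?thesis by linarith
  qed
  then have "\<bar>(\<integral>x. f (X x) \<partial>M) - (\<integral>x. f (Y x) \<partial>N)\<bar> \<le> 0"
    using field_le_epsilon[of "\<bar>(\<integral>x. f (X x) \<partial>M) - (\<integral>x. f (Y x)
        \<partial>N)\<bar>" 0] by simp
  then show ?thesis by simp
qed

text \<open>Tent functions around \<open>y\<close> decrease to the indicator of the point. Equal
  moments give each of them equal integrals on both sides, and those for \<open>Y\<close> tend to
  0.\<close>

lemma no_atom_if_moments_eq:
  fixes X :: "'a \<Rightarrow> real" and Y :: "'b \<Rightarrow> real"
  assumes M: "prob_space M" "X \<in> borel_measurable M" "\<And>x. X x \<in> {0..1}"
    and N: "prob_space N" "Y \<in> borel_measurable N" "\<And>x. Y x \<in> {0..1}"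
    and moments: "\<And>k::nat. (\<integral>x. X x ^ k \<partial>M) = (\<integral>x. Y x ^ k \<partial>N)"
    and null: "measure N {x\<in>space N. Y x = y} = 0"
  shows "measure M {x\<in>space M. X x = y} = 0"
proof -
  interpret M: prob_space M by fact
  interpret N: prob_space N by fact
  note [measurable] = M(2) N(2)
  define f where "f j x = max 0 (1 - real j * \<bar>x - y\<bar>)" for j x
  have cont: "continuous_on UNIV (f j)" for j
    unfolding f_def by (intro continuous_intros)
  have f: "0 \<le> f j x" "f j x \<le> 1" "f j y = 1" for j x by (auto simp: f_def)
  have [measurable]: "f j \<in> borel_measurable borel" for j
    by (rule borel_measurable_continuous_onI[OF cont])
  have "(\<lambda>j. \<integral>x. f j (Y x) \<partial>N)
      \<longlonglongrightarrow> (\<integral>x. indicator {x\<in>space N. Y x = y} x \<partial>N)"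
  proof (rule integral_dominated_convergence[where w="\<lambda>_. 1"])
    have lim1: "(\<lambda>j. f j t) \<longlonglongrightarrow> (if t = y then 1 else 0)" for t
    proof (cases "t = y")
      case False
      have "\<forall>\<^sub>F j in sequentially. 1 / \<bar>t - y\<bar> \<le> real j"
        using filterlim_real_sequentially by (simp add: filterlim_at_top)
      then have "\<forall>\<^sub>F j in sequentially. f j t = 0"
        by eventually_elim (use False in \<open>auto simp: f_def field_simps\<close>)
      then show ?thesis using False by (simp add: tendsto_eventually)
    qed (simp add: f)
    show "AE x in N. (\<lambda>j. f j (Y x)) \<longlonglongrightarrow> indicator {x\<in>space N. Y x = y} x"
    proof (rule AE_I2)
      fix x assume "x \<in> space N"
      then show "(\<lambda>j. f j (Y x)) \<longlonglongrightarrow> indicator {x\<in>space N. Y x = y} x"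
        using lim1[of "Y x"] by (cases "Y x = y") (simp_all add: indicator_def)
    qed
  qed (use f in auto)
  then have lim: "(\<lambda>j. \<integral>x. f j (X x) \<partial>M) \<longlonglongrightarrow> 0"
    using null integral_eq_if_moments_eq[OF M N moments cont] by simp
  have "measure M {x\<in>space M. X x = y} \<le> (\<integral>x. f j (X x) \<partial>M)" for j
  proof -
    have "measure M {x\<in>space M. X x = y} = (\<integral>x. indicator {x\<in>space M. X x
        = y} x \<partial>M)"
      by simp
    also have "\<dots> \<le> (\<integral>x. f j (X x) \<partial>M)"
      by (intro integral_mono M.integrable_const_bound[of _ 1])
        (use f in \<open>auto simp: indicator_def\<close>)
    finally show ?thesis .
  qed
  then have "measure M {x\<in>space M. X x = y} \<le> 0"
    by (intro LIMSEQ_le_const[OF lim]) auto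
  then show ?thesis using measure_nonneg[of M] by (simp add: order_antisym)
qed

text \<open>Integer powers of \<open>exp (- |x|^2)\<close> integrate to values of the Laplace
  transform, so this variable has the moments of \<open>exp (- q z)\<close> under
  \<open>std_gauss\<close>, and atoms can be examined on the side that has a Lebesgue
  density.\<close>

lemma gaussian_norm_no_atom:
  fixes \<mu> :: "'a::euclidean_space measure"
  assumes \<mu>: "prob_space \<mu>" "sets \<mu> = sets borel"
    and char: "\<And>a. (CLINT x|\<mu>. iexp (a \<bullet> x)) = complex_of_real (exp (- q a / 2))"
    and hom: "\<And>r a. q (r *\<^sub>R a) = r\<^sup>2 * q a" and q: "continuous_on UNIV q"
        "\<And>a. 0 \<le> q a"
    and c: "c > 0"
  shows "measure \<mu> {x. (norm x)\<^sup>2 = c} = 0"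
proof -
  note [measurable_cong] = \<mu>(2)
  note [measurable] = borel_measurable_continuous_onI[OF q(1)]
  have "measure \<mu> {x\<in>space \<mu>. exp (- (norm x)\<^sup>2) = exp (- c)} = 0"
  proof (rule no_atom_if_moments_eq[where N = std_gauss and Y = "\<lambda>z. exp (- q z)"])
    show "prob_space (std_gauss :: 'a measure)" by (rule prob_space_std_gauss)
    show "(\<integral>x. exp (- (norm x)\<^sup>2) ^ k \<partial>\<mu>)
        = (\<integral>z. exp (- q z) ^ k \<partial>std_gauss)" for k :: nat
      using gaussian_laplace_norm[OF \<mu> char hom, of "real k"] by (simp add: exp_of_nat_mult[symmetric])
    have "closed {z. q z = c}"
      using continuous_closed_vimage[of "{c}" q] q(1)
          by (simp add: vimage_def continuous_on_eq_continuous_at)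
    moreover have "negligible {z. q z = c}"
    \<comment> \<open>Homogeneity gives \<open>r^2 * c = c\<close>, and \<open>c > 0\<close> forces
      \<open>r = 1\<close>: a ray from the origin meets the level set at most once.\<close>
    proof (rule starlike_negligible[of _ 0])
      show "closed {z. q z = c}" by fact
      fix r x assume "0 + r *\<^sub>R x \<in> {z. q z = c}" "0 \<le> r" "0 + x \<in> {z. q z = c}"
      then show "r = 1" using c hom[of r x] by (simp add: power2_eq_1_iff)
    qed
    ultimately have "measure std_gauss {z. q z = c} = 0"
      by (intro std_gauss_null) auto
    moreover have "{z \<in> space std_gauss. exp (- q z) = exp (- c)} = {z. q z = c}"
      by (simp add: std_gauss_def)
    ultimately show "measure std_gauss {z \<in> space std_gauss. exp (- q z) = exp (- c)} = 0"
      by simp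
  qed (use \<mu> q in auto)
  then show ?thesis using sets_eq_imp_space_eq[OF \<mu>(2)] by simp
qed

section \<open>Marginals and projections of a Gaussian matrix\<close>

lemma centered_normal_scale:
  assumes "0 < v"
  shows "centered_normal v = distr std_normal_distribution borel (\<lambda>x. sqrt v * x)"
proof -
  interpret prob_space std_normal_distribution
    by (rule prob_space_normal_density) simp
  have "distributed std_normal_distribution lborel (\<lambda>x. x) std_normal_density"
    unfolding distributed_def by (auto simp: distr_id2)
  then have "distributed std_normal_distribution lborel (\<lambda>x. 0 + sqrt v * x)
      (normal_density (0 + sqrt v * 0) (\<bar>sqrt v\<bar> * 1))"
    by (rule normal_density_affine) (use assms in auto)
  then have "distr std_normal_distribution lborel (\<lambda>x. sqrt v * x)
      = density lborel (normal_density 0 (sqrt v))"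
    using assms by (simp add: distributed_def)
  then show ?thesis
    using assms by (simp add: centered_normal_def cong: distr_cong)
qed

lemma char_centered_normal:
  assumes "0 \<le> v"
  shows "(CLINT x|centered_normal v. iexp x) = complex_of_real (exp (- v / 2))"
proof (cases "v = 0")
  case True
  then show ?thesis by (simp add: centered_normal_def integral_return)
next
  case False
  with assms have v: "0 < v" by simp
  have "(CLINT x|centered_normal v. iexp x) = char std_normal_distribution (sqrt v)"
    unfolding centered_normal_scale[OF v] char_def by (subst integral_distr) auto
  then show ?thesis using v by (simp add: char_std_normal_distribution)
qed

text \<open>Vectorization is an isometry, so the linear functionals of the stacked vector, through
  which the Gaussian law is defined, are the Frobenius inner products with the matrix.\<close>

lemma inner_vec_cols: "vec_cols a \<bullet> vec_cols b = a \<bullet> (b :: real^'h^'p)"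
proof -
  have "vec_cols a \<bullet> vec_cols b = (\<Sum>k\<in>UNIV \<times> UNIV. a $ snd k $ fst k * b $
      snd k $ fst k)"
    by (simp add: vec_cols_def inner_vec_def)
  also have "\<dots> = (\<Sum>j\<in>UNIV. \<Sum>i\<in>UNIV. a $ i $ j * b $ i $ j)"
    by (subst sum.cartesian_product) (simp add: split_beta)
  also have "\<dots> = a \<bullet> b"
    by (subst sum.swap) (simp add: inner_vec_def)
  finally show ?thesis .
qed

lemma linear_vec_cols: "linear (vec_cols :: real^'h^'p \<Rightarrow> _)"
  by (rule linearI) (simp_all add: vec_cols_def vec_eq_iff)

lemma borel_measurable_vec_cols [measurable]: "vec_cols \<in> borel_measurable borel"
  by (intro borel_measurable_continuous_onI linear_continuous_on linear_conv_bounded_linear[THEN iffD1]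
      linear_vec_cols)

text \<open>\<open>\<pi>\<close> is the orthogonal projection onto the complement of
  \<open>T\<close>. It turns the distance of a Gaussian vector to \<open>T\<close> into the norm of
  its linear image, and self-adjointness gives the characteristic function of that image.\<close>

lemma subspace_projection:
  fixes T :: "'a::euclidean_space set"
  assumes T: "subspace T"
  obtains \<pi> where "linear \<pi>" "\<And>a w. a \<bullet> \<pi> w = \<pi> a \<bullet> w"
      "\<And>w. infdist w T = norm (\<pi> w)"
proof -
  obtain F where F: "F \<subseteq> T" "pairwise orthogonal F" "\<And>x. x \<in> F
      \<Longrightarrow> norm x = 1"
    "independent F" "card F = dim T" "span F = T"
    by (rule orthonormal_basis_subspace[OF T]) (rule that)
  have fin: "finite F" using F(4) by (rule independent_imp_finite)
  define \<pi> where "\<pi> w = w - (\<Sum>f\<in>F. (f \<bullet> w) *\<^sub>R f)" for w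
  have lin: "linear \<pi>"
    by (rule linearI) (simp_all add: \<pi>_def inner_right_distrib scaleR_left_distrib sum.distrib
        scaleR_diff_right scaleR_sum_right)
  have adj: "a \<bullet> \<pi> w = \<pi> a \<bullet> w" for a w
    by (simp add: \<pi>_def inner_diff_left inner_diff_right inner_sum_left inner_sum_right
        inner_commute mult.commute)
  have orth_F: "f \<bullet> \<pi> w = 0" if "f \<in> F" for f w
  proof -
    have "(\<Sum>g\<in>F. (g \<bullet> w) * (f \<bullet> g)) = (\<Sum>g\<in>F. if g
        = f then f \<bullet> w else 0)"
      using F(2,3) that by (intro sum.cong) (auto simp: pairwise_def orthogonal_def norm_eq_1)
    then show ?thesis using that fin by (simp add: \<pi>_def inner_diff_right inner_sum_right)
  qed
  have orth: "orthogonal (\<pi> w) t" if "t \<in> T" for w t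
    using that unfolding F(6)[symmetric]
    by (rule orthogonal_to_span) (use orth_F in \<open>simp add: orthogonal_def inner_commute\<close>)
  have mem: "w - \<pi> w \<in> T" for w
  proof -
    have "(\<Sum>f\<in>F. (f \<bullet> w) *\<^sub>R f) \<in> span F"
      by (intro span_sum span_scale span_base)
    then show ?thesis by (simp add: F(6) \<pi>_def)
  qed
  have "infdist w T = norm (\<pi> w)" for w
  proof (rule antisym)
    show "infdist w T \<le> norm (\<pi> w)"
      using infdist_le[OF mem[of w], of w] by (simp add: dist_norm)
    have "T \<noteq> {}" using mem by auto
    then obtain t where t: "t \<in> T" "infdist w T = dist w t"
      using infdist_attains_inf[OF closed_subspace[OF T]] by blast
    have "w - \<pi> w - t \<in> T" using mem t T by (simp add: subspace_diff)
    then have "(norm (\<pi> w + (w - \<pi> w - t)))\<^sup>2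
        = (norm (\<pi> w))\<^sup>2 + (norm (w - \<pi> w - t))\<^sup>2"
      by (rule norm_add_Pythagorean[OF orth])
    then have "(norm (\<pi> w))\<^sup>2 \<le> (norm (w - t))\<^sup>2" by simp
    then show "norm (\<pi> w) \<le> infdist w T"
      using t by (simp add: dist_norm power2_le_iff_abs_le)
  qed
  with lin adj show ?thesis by (rule that)
qed

text \<open>An atom at 0 is excluded by the functional \<open>a\<close>, which vanishes on
  \<open>T\<close> but has positive variance; an atom at a positive value is excluded by
  \<open>gaussian_norm_no_atom\<close> for the projected vector.\<close>

lemma gaussian_infdist_no_atom:
  fixes W :: "'c \<Rightarrow> real^'h^'p"
  assumes N: "prob_space N" and W: "W \<in> borel_measurable N"
    and gauss: "is_centered_gaussian (distr N borel (\<lambda>x. vec_cols (W x))) \<Gamma>"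
    and T: "subspace T" and a: "\<And>t. t \<in> T \<Longrightarrow> a \<bullet> t = 0"
        "\<not> (AE x in N. a \<bullet> W x = 0)"
  shows "measure N {x\<in>space N. (infdist (W x) T)\<^sup>2 = c} = 0"
proof -
  interpret prob_space N by fact
  note [measurable] = W
  define q where "q b = vec_cols b \<bullet> (\<Gamma> *v vec_cols b)" for b :: "real^'h^'p"
  have q0: "0 \<le> q b" for b
    using gauss unfolding is_centered_gaussian_def q_def by blast
  have law: "distr N borel (\<lambda>x. b \<bullet> W x) = centered_normal (q b)" for b
  proof -
    have "distr N borel (\<lambda>x. b \<bullet> W x)
        = distr (distr N borel (\<lambda>x. vec_cols (W x))) borel (\<lambda>x. vec_cols b \<bullet> x)"
      by (subst distr_distr) (simp_all add: comp_def inner_vec_cols)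
    then show ?thesis
      using gauss unfolding is_centered_gaussian_def q_def by simp
  qed
  have charW: "(CLINT x|N. iexp (b \<bullet> W x)) = complex_of_real (exp (- q b / 2))" for b
  proof -
    have "(CLINT x|N. iexp (b \<bullet> W x))
        = (CLINT x|distr N borel (\<lambda>x. b \<bullet> W x). iexp x)"
      by (subst integral_distr) auto
    then show ?thesis unfolding law by (simp add: char_centered_normal q0)
  qed
  have null0: "measure N {x\<in>space N. a \<bullet> W x = 0} = 0"
  proof -
    \<comment> \<open>With variance 0 the law of \<open>a \<bullet> W\<close> is the point mass at
      0, contrary to the assumption on \<open>a\<close>; with positive variance it has a
      density.\<close>
    have "q a \<noteq> 0"
    proof
      assume "q a = 0"
      then have "AE x in distr N borel (\<lambda>x. a \<bullet> W x). x = 0"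
        unfolding law centered_normal_def by (subst if_P, simp, subst AE_return) auto
      then have "AE x in N. a \<bullet> W x = 0"
        by (subst (asm) AE_distr_iff) auto
      with a(2) show False by simp
    qed
    then have "emeasure (centered_normal (q a)) {0} = 0"
      by (simp add: centered_normal_def emeasure_density nn_integral_cmult_indicator
          nn_integral_indicator_singleton)
    then have "emeasure N ((\<lambda>x. a \<bullet> W x) -` {0} \<inter> space N) = 0"
      unfolding law[symmetric] by (subst (asm) emeasure_distr) auto
    moreover have "(\<lambda>x. a \<bullet> W x) -` {0} \<inter> space N
        = {x\<in>space N. a \<bullet> W x = 0}" by auto
    ultimately show ?thesis by (simp add: measure_def)
  qed
  consider "c < 0" | "c = 0" | "c > 0" by linarith
  then show ?thesis
  proof cases
    case 1
    then have "{x\<in>space N. (infdist (W x) T)\<^sup>2 = c} = {}"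
      by (auto simp: not_le[symmetric])
    then show ?thesis by (simp only: measure_empty)
  next
    case 2
    \<comment> \<open>Distance 0 to the closed set \<open>T\<close> means membership in
      \<open>T\<close>, where \<open>a\<close> vanishes.\<close>
    have "{x\<in>space N. (infdist (W x) T)\<^sup>2 = c} \<subseteq> {x\<in>space N. a \<bullet> W x = 0}"
      using 2 a(1) in_closed_iff_infdist_zero[OF closed_subspace[OF T]] subspace_0[OF T] by auto
    then have "measure N {x\<in>space N. (infdist (W x) T)\<^sup>2 = c}
        \<le> measure N {x\<in>space N. a \<bullet> W x = 0}"
      by (intro finite_measure_mono) auto
    then show ?thesis using null0 measure_nonneg[of N] by (simp add: order_antisym)
  next
    case 3
    obtain \<pi> where \<pi>: "linear \<pi>" "\<And>a w. a \<bullet> \<pi> w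
        = \<pi> a \<bullet> w" "\<And>w. infdist w T = norm (\<pi> w)"
      by (rule subspace_projection[OF T]) (rule that)
    have cont: "continuous_on UNIV \<pi>"
      using \<pi>(1) by (simp add: linear_continuous_on linear_conv_bounded_linear)
    note [measurable] = borel_measurable_continuous_onI[OF cont]
    let ?\<mu> = "distr N borel (\<lambda>x. \<pi> (W x))"
    \<comment> \<open>As \<open>\<pi>\<close> is self-adjoint, the projected vector has variance
      \<open>q (\<pi> b)\<close> in the direction \<open>b\<close>.\<close>
    have "measure ?\<mu> {x. (norm x)\<^sup>2 = c} = 0"
    proof (rule gaussian_norm_no_atom[where q = "\<lambda>b. q (\<pi> b)"])
      show "prob_space ?\<mu>" by (rule prob_space_distr) simp
      show "(CLINT x|?\<mu>. iexp (b \<bullet> x)) = complex_of_real (exp (- q (\<pi> b) / 2))" for b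
        by (subst integral_distr) (simp_all add: \<pi>(2) charW)
      show "q (\<pi> (r *\<^sub>R b)) = r\<^sup>2 * q (\<pi> b)" for r b
        by (simp add: q_def linear_scale[OF \<pi>(1)] linear_scale[OF linear_vec_cols]
            matrix_vector_mult_scaleR power2_eq_square)
      show "continuous_on UNIV (\<lambda>b. q (\<pi> b))"
        unfolding q_def
        by (intro continuous_intros continuous_on_compose2[OF linear_continuous_on cont]
            linear_conv_bounded_linear[THEN iffD1] linear_vec_cols
            continuous_on_compose2[OF linear_continuous_on[of "(*v) \<Gamma>"]]
                matrix_vector_mul_linear) auto
    qed (use q0 3 in auto)
    then have "measure N ((\<lambda>x. \<pi> (W x)) -` {x. (norm x)\<^sup>2 = c} \<inter> space N) = 0"
      by (subst (asm) measure_distr) auto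
    moreover have "(\<lambda>x. \<pi> (W x)) -` {x. (norm x)\<^sup>2 = c} \<inter> space N
        = {x\<in>space N. (infdist (W x) T)\<^sup>2 = c}"
      using \<pi>(3) by auto
    ultimately show ?thesis by simp
  qed
qed

section \<open>Conditional laws and quantiles\<close>

text \<open>The Galois connection between a right-continuous distribution function and its
  generalized inverse; for a level strictly inside the unit interval the infimum is over a nonempty
  set bounded below. Later statements on quantiles are reduced by it to distribution functions at
  fixed points.\<close>

lemma quantile_le_iff:
  assumes "prob_space \<mu>" "sets \<mu> = sets borel" "0 < \<alpha>" "\<alpha> < 1"
  shows "quantile \<mu> \<alpha> \<le> x \<longleftrightarrow> \<alpha> \<le> cdf \<mu> x"
proof -
  interpret prob_space \<mu> by fact
  interpret real_distribution \<mu> by standard (use assms(2) in auto)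
  interpret cdf_distribution \<mu> ..
  show ?thesis
    unfolding quantile_def using pseudoinverse[of \<alpha> x] assms(3,4) by simp
qed

lemma prob_algebra_borelD:
  assumes "K \<in> measurable F (prob_algebra borel)" "\<omega> \<in> space F"
  shows "prob_space (K \<omega>)" "sets (K \<omega>) = sets borel"
  using measurable_space[OF assms] by (auto simp: space_prob_algebra)

text \<open>By \<open>quantile_le_iff\<close> the sublevel sets of the quantile are superlevel sets
  of the measure of \<open>{..x}\<close>, which is measurable in \<open>\<omega>\<close>.\<close>

lemma borel_measurable_quantile:
  assumes K: "K \<in> measurable F (prob_algebra borel)" and \<alpha>: "0 < \<alpha>" "\<alpha> < 1"
  shows "(\<lambda>\<omega>. quantile (K \<omega>) \<alpha>) \<in> borel_measurable F"
  unfolding borel_measurable_iff_le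
proof
  fix x :: real
  have "(\<lambda>\<omega>. measure (K \<omega>) {..x}) \<in> borel_measurable F"
    using measurable_prob_algebraD[OF K] by (intro measure_measurable_subprob_algebra2) auto
  then have "{\<omega>\<in>space F. \<alpha> \<le> measure (K \<omega>) {..x}} \<in> sets F" by simp
  moreover have "{\<omega>\<in>space F. quantile (K \<omega>) \<alpha> \<le> x}
      = {\<omega>\<in>space F. \<alpha> \<le> measure (K \<omega>) {..x}}"
    using quantile_le_iff[OF prob_algebra_borelD[OF K] \<alpha>] by (auto simp: cdf_def)
  ultimately show "{\<omega>\<in>space F. quantile (K \<omega>) \<alpha> \<le> x} \<in> sets F" by simp
qed

text \<open>For measurable rectangles the identity is the definition of the conditional law; it
  extends to the product sigma-algebra by induction on disjoint unions and complements. The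
  integrated form keeps the null sets, which depend on the event, out of this induction.\<close>

lemma cond_law_joint_nn_integral:
  fixes X :: "'a \<Rightarrow> 'b::topological_space"
  assumes M: "prob_space M" and F: "subalgebra M F" and X: "X \<in> borel_measurable M"
    and K: "is_cond_law M F X K" and A: "A \<in> sets F" and S: "S \<in> sets (F \<Otimes>\<^sub>M borel)"
  shows "(\<integral>\<^sup>+\<omega>. indicator A \<omega> * indicator S (\<omega>, X \<omega>)
      \<partial>M)
       = (\<integral>\<^sup>+\<omega>. indicator A \<omega> * emeasure (K \<omega>) (Pair \<omega>
           -` S) \<partial>M)"
proof -
  interpret M: prob_space M by fact
  interpret finite_measure_subalgebra M F by standard (rule F)
  have space: "space F = space M" using F by (simp add: subalgebra_def)
  have FM: "B \<in> sets M" if "B \<in> sets F" for B using F that by (auto simp: subalgebra_def)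
  have KF: "K \<in> measurable F (prob_algebra borel)"
    using K by (simp add: is_cond_law_def)
  note Kprob = prob_algebra_borelD[OF KF, unfolded space]
  note [measurable] = X FM[OF A]
  have idX: "(\<lambda>\<omega>. (\<omega>, X \<omega>)) \<in> measurable M (F \<Otimes>\<^sub>M borel)"
    using F X by (intro measurable_Pair) (auto intro: measurable_from_subalg)
  have Kmeas: "(\<lambda>\<omega>. emeasure (K \<omega>) (Pair \<omega> -` S)) \<in> borel_measurable M"
    if "S \<in> sets (F \<Otimes>\<^sub>M borel)" for S
  proof -
    have "(SIGMA \<omega>:space F. Pair \<omega> -` S) = S"
      using sets.sets_into_space[OF that] by (auto simp: space_pair_measure)
    then have "(\<lambda>\<omega>. emeasure (K \<omega>) (Pair \<omega> -` S)) \<in> borel_measurable F"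
      using measurable_prob_algebraD[OF KF] that by (intro emeasure_measurable_subprob_algebra2) auto
    then show ?thesis using F by (rule measurable_from_subalg[rotated])
  qed
  have indmeas: "(\<lambda>\<omega>. indicator S (\<omega>, X \<omega>) :: ennreal) \<in>
      borel_measurable M"
    if "S \<in> sets (F \<Otimes>\<^sub>M borel)" for S
    using measurable_compose[OF idX borel_measurable_indicator[OF that]] .
  let ?l = "\<lambda>S. \<integral>\<^sup>+\<omega>. indicator A \<omega> * indicator S (\<omega>,
      X \<omega>) \<partial>M"
  let ?r = "\<lambda>S. \<integral>\<^sup>+\<omega>. indicator A \<omega> * emeasure (K \<omega>)
      (Pair \<omega> -` S) \<partial>M"
  let ?G = "{a \<times> b | a b. a \<in> sets F \<and> b \<in> sets (borel :: 'b measure)}"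
  let ?\<Omega> = "space F \<times> space (borel :: 'b measure)"
  have sets_eq: "sets (F \<Otimes>\<^sub>M (borel :: 'b measure)) = sigma_sets ?\<Omega> ?G"
    by (rule sets_pair_measure)
  have "S \<in> sigma_sets ?\<Omega> ?G" using S by (simp only: sets_eq)
  then show "?l S = ?r S"
  proof (induction rule: sigma_sets_induct_disjoint[OF Int_stable_pair_measure_generator
        pair_measure_closed, consumes 1, case_names basic empty compl union])
    \<comment> \<open>For a rectangle the factor \<open>a\<close> is absorbed into the conditioning
      event \<open>A \<inter> a\<close>, which belongs to \<open>F\<close>.\<close>
    case (basic S)
    then obtain a b where S: "S = a \<times> b" "a \<in> sets F" "b \<in> sets borel" by auto
    let ?f = "indicat_real (X -` b \<inter> space M)"
    have Xb: "X -` b \<inter> space M \<in> sets M" using S by measurable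
    have aA: "A \<inter> a \<in> sets F" using S A by auto
    have AEK: "AE \<omega> in M. measure (K \<omega>) b = real_cond_exp M F ?f \<omega>"
      using K S by (simp add: is_cond_law_def)
    have Kb: "(\<lambda>\<omega>. measure (K \<omega>) b) \<in> borel_measurable M"
      using measurable_prob_algebraD[OF KF] S
      by (intro measurable_from_subalg[OF F] measure_measurable_subprob_algebra2) auto
    have "(\<integral>\<omega>\<in>A \<inter> a. ?f \<omega> \<partial>M)
        = (\<integral>\<omega>\<in>A \<inter> a. real_cond_exp M F ?f \<omega> \<partial>M)"
      using Xb aA by (intro real_cond_exp_intA) (auto simp: M.emeasure_eq_measure)
    also have "\<dots> = (\<integral>\<omega>\<in>A \<inter> a. measure (K \<omega>) b \<partial>M)"
      unfolding set_lebesgue_integral_def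
      using AEK Kb FM[OF aA] by (intro integral_cong_AE) auto
    finally have eq: "(\<integral>\<omega>. indicator (A \<inter> a) \<omega> * ?f \<omega>
        \<partial>M) = (\<integral>\<omega>. indicator (A \<inter> a) \<omega> * measure (K
        \<omega>) b \<partial>M)"
      by (simp add: set_lebesgue_integral_def)
    have "?l S = (\<integral>\<^sup>+\<omega>. ennreal (indicator (A \<inter> a) \<omega> * ?f
        \<omega>) \<partial>M)"
      unfolding S(1) by (intro nn_integral_cong) (auto simp: indicator_def)
    also have "\<dots> = ennreal (\<integral>\<omega>. indicator (A \<inter> a) \<omega> * ?f
        \<omega> \<partial>M)"
      using Xb FM[OF aA] 
      by (intro nn_integral_eq_integral M.integrable_const_bound[of _ 1] AE_I2
          borel_measurable_times borel_measurable_indicator) (auto simp: indicator_def)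
    also have "\<dots> = ennreal (\<integral>\<omega>. indicator (A \<inter> a) \<omega> * measure
        (K \<omega>) b \<partial>M)"
      by (simp only: eq)
    also have "\<dots> = (\<integral>\<^sup>+\<omega>. ennreal (indicator (A \<inter> a) \<omega> *
        measure (K \<omega>) b) \<partial>M)"
      using Kb FM[OF aA] Kprob
      by (intro nn_integral_eq_integral[symmetric] M.integrable_const_bound[of _ 1] AE_I2
          borel_measurable_times borel_measurable_indicator)
        (auto simp: indicator_def intro!: prob_space.prob_le_1)
    also have "\<dots> = ?r S"
      unfolding S(1) using Kprob
      by (intro nn_integral_cong)
        (auto simp: indicator_def finite_measure.emeasure_eq_measure prob_space.finite_measure)
    finally show ?case .
  next
    case empty
    then show ?case by simp
  next
    case (compl S)
    have S: "S \<in> sets (F \<Otimes>\<^sub>M borel)"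
        and cS: "?\<Omega> - S \<in> sets (F \<Otimes>\<^sub>M borel)"
      using compl(1) by (simp_all only: sets_eq sigma_sets.Compl)
    \<comment> \<open>Both sides are additive over \<open>S\<close> and its complement with the same
      total, the measure of \<open>A\<close>; the finite term \<open>?l S\<close> is then
      cancelled.\<close>
    have "?l S + ?l (?\<Omega> - S) = (\<integral>\<^sup>+\<omega>. indicator A \<omega> \<partial>M)"
    proof (subst nn_integral_add[symmetric])
      show "(\<integral>\<^sup>+\<omega>. indicator A \<omega> * indicator S (\<omega>, X \<omega>)
          + indicator A \<omega> * indicator (?\<Omega> - S) (\<omega>, X \<omega>) \<partial>M)
          = (\<integral>\<^sup>+\<omega>. indicator A \<omega> \<partial>M)"
        by (rule nn_integral_cong) (auto simp: indicator_def space)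
    qed (use indmeas[OF S] indmeas[OF cS] in auto)
    also have "\<dots> = ?r S + ?r (?\<Omega> - S)"
    proof (subst nn_integral_add[symmetric])
      show "(\<integral>\<^sup>+\<omega>. indicator A \<omega> \<partial>M)
          = (\<integral>\<^sup>+\<omega>. indicator A \<omega> * emeasure (K \<omega>) (Pair \<omega> -` S)
          + indicator A \<omega> * emeasure (K \<omega>) (Pair \<omega> -` (?\<Omega> - S)) \<partial>M)"
      proof (rule nn_integral_cong)
        fix \<omega> assume w: "\<omega> \<in> space M"
        interpret K: prob_space "K \<omega>" using Kprob w by auto
        have spK: "space (K \<omega>) = UNIV"
          using sets_eq_imp_space_eq[OF Kprob(2)[OF w]] by simp
        have "Pair \<omega> -` (?\<Omega> - S) = space (K \<omega>) - Pair \<omega> -` S"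
          using w by (auto simp: space spK)
        moreover have "Pair \<omega> -` S \<in> sets (K \<omega>)"
          using S Kprob(2)[OF w] by (simp add: sets_Pair1)
        ultimately have "emeasure (K \<omega>) (Pair \<omega> -` S) + emeasure (K \<omega>) (Pair
            \<omega> -` (?\<Omega> - S)) = 1"
          by (simp add: K.emeasure_eq_measure K.prob_compl flip: ennreal_plus)
        then show "indicator A \<omega> = indicator A \<omega> * emeasure (K \<omega>) (Pair \<omega> -` S)
          + indicator A \<omega> * emeasure (K \<omega>) (Pair \<omega> -` (?\<Omega> - S))"
          by (simp add: distrib_left[symmetric])
      qed
    qed (use Kmeas[OF S] Kmeas[OF cS] in auto)
    finally have "?l S + ?l (?\<Omega> - S) = ?l S + ?r (?\<Omega> - S)"
      using compl.IH by simp
    moreover have "?l S \<noteq> \<infinity>"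
    proof -
      have "?l S \<le> (\<integral>\<^sup>+\<omega>. 1 \<partial>M)"
          by (intro nn_integral_mono) (auto simp: indicator_def)
      then show ?thesis by (auto simp: M.emeasure_space_1 top_unique)
    qed
    ultimately show ?case by (simp add: ennreal_add_left_cancel)
  next
    case (union S)
    have S: "S i \<in> sets (F \<Otimes>\<^sub>M borel)" for i
      using union(2) by (auto simp only: sets_eq)
    have "?l (\<Union>i. S i) = (\<integral>\<^sup>+\<omega>. (\<Sum>i. indicator A \<omega> *
        indicator (S i) (\<omega>, X \<omega>)) \<partial>M)"
      by (intro nn_integral_cong) (simp add: suminf_indicator[OF union(1)])
    also have "\<dots> = (\<Sum>i. ?l (S i))"
      using indmeas[OF S] by (intro nn_integral_suminf) auto
    also have "\<dots> = (\<Sum>i. ?r (S i))"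
      by (simp only: union(3))
    also have "\<dots> = (\<integral>\<^sup>+\<omega>. (\<Sum>i. indicator A \<omega> * emeasure (K
        \<omega>) (Pair \<omega> -` S i)) \<partial>M)"
      using Kmeas[OF S] by (intro nn_integral_suminf[symmetric]) auto
    also have "\<dots> = ?r (\<Union>i. S i)"
    proof (rule nn_integral_cong)
      fix \<omega> assume w: "\<omega> \<in> space M"
      have "(\<Sum>i. emeasure (K \<omega>) (Pair \<omega> -` S i))
          = emeasure (K \<omega>) (\<Union>i. Pair \<omega> -` S i)"
      proof (rule suminf_emeasure)
        show "range (\<lambda>i. Pair \<omega> -` S i) \<subseteq> sets (K \<omega>)"
          using S Kprob(2)[OF w] by (auto simp: sets_Pair1)
        show "disjoint_family (\<lambda>i. Pair \<omega> -` S i)"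
          using union(1) unfolding disjoint_family_on_def by blast
      qed
      then show "(\<Sum>i. indicator A \<omega> * emeasure (K \<omega>) (Pair \<omega> -` S i))
          = indicator A \<omega> * emeasure (K \<omega>) (Pair \<omega> -` (\<Union>i. S i))"
        by (simp add: vimage_UN)
    qed
    finally show ?case .
  qed
qed

text \<open>Freezing: given \<open>F\<close>, the first argument of an event on the pair of
  \<open>\<omega>\<close> and \<open>X \<omega>\<close> can be treated as a constant. The integrated
  identity and the characterization of conditional expectation give this.\<close>

lemma cond_law_joint:
  fixes X :: "'a \<Rightarrow> 'b::topological_space"
  assumes M: "prob_space M" and F: "subalgebra M F" and X: "X \<in> borel_measurable M"
    and K: "is_cond_law M F X K" and S: "S \<in> sets (F \<Otimes>\<^sub>M borel)"
  shows "AE \<omega> in M. real_cond_exp M F (indicat_real {\<omega>\<in>space M. (\<omega>, X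
      \<omega>) \<in> S}) \<omega>
      = measure (K \<omega>) (Pair \<omega> -` S)"
proof -
  interpret M: prob_space M by fact
  interpret finite_measure_subalgebra M F by standard (rule F)
  have space: "space F = space M" using F by (simp add: subalgebra_def)
  have FM: "B \<in> sets M" if "B \<in> sets F" for B using F that by (auto simp: subalgebra_def)
  have KF: "K \<in> measurable F (prob_algebra borel)"
    using K by (simp add: is_cond_law_def)
  note Kprob = prob_algebra_borelD[OF KF, unfolded space]
  let ?g = "\<lambda>\<omega>. measure (K \<omega>) (Pair \<omega> -` S)"
  let ?D = "{\<omega>\<in>space M. (\<omega>, X \<omega>) \<in> S}"
  have idX: "(\<lambda>\<omega>. (\<omega>, X \<omega>)) \<in> measurable M (F \<Otimes>\<^sub>M borel)"
    using F X by (intro measurable_Pair) (auto intro: measurable_from_subalg)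
  have D: "?D \<in> sets M"
    using measurable_sets[OF idX S] by (simp add: vimage_def Int_def conj_commute)
  have "(SIGMA \<omega>:space F. Pair \<omega> -` S) = S"
    using sets.sets_into_space[OF S] by (auto simp: space_pair_measure)
  then have gF: "?g \<in> borel_measurable F"
    using measurable_prob_algebraD[OF KF] S by (intro measure_measurable_subprob_algebra2) auto
  then have gM: "?g \<in> borel_measurable M"
    using F by (rule measurable_from_subalg[rotated])
  show ?thesis
  proof (rule real_cond_exp_charact)
    fix A assume A: "A \<in> sets F"
    have "(\<integral>\<omega>\<in>A. indicat_real ?D \<omega> \<partial>M)
        = enn2real (\<integral>\<^sup>+\<omega>. ennreal (indicator A \<omega> * indicat_real ?D
        \<omega>) \<partial>M)"
      unfolding set_lebesgue_integral_def using D FM[OF A]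
      by (subst integral_eq_nn_integral) auto
    also have "(\<integral>\<^sup>+\<omega>. ennreal (indicator A \<omega> * indicat_real ?D
        \<omega>) \<partial>M)
        = (\<integral>\<^sup>+\<omega>. indicator A \<omega> * indicator S (\<omega>, X \<omega>)
            \<partial>M)"
      by (intro nn_integral_cong) (auto simp: indicator_def)
    also have "\<dots> = (\<integral>\<^sup>+\<omega>. indicator A \<omega> * emeasure (K \<omega>)
        (Pair \<omega> -` S) \<partial>M)"
      by (rule cond_law_joint_nn_integral[OF M F X K A S])
    also have "\<dots> = (\<integral>\<^sup>+\<omega>. ennreal (indicator A \<omega> * ?g \<omega>)
        \<partial>M)"
      using Kprob by (intro nn_integral_cong)
        (auto simp: indicator_def finite_measure.emeasure_eq_measure prob_space.finite_measure)
    also have "enn2real \<dots> = (\<integral>\<omega>\<in>A. ?g \<omega> \<partial>M)"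
      unfolding set_lebesgue_integral_def using gM FM[OF A]
      by (subst integral_eq_nn_integral) auto
    finally show "(\<integral>\<omega>\<in>A. indicat_real ?D \<omega> \<partial>M)
        = (\<integral>\<omega>\<in>A. ?g \<omega> \<partial>M)" .
  next
    show "integrable M ?g"
      using gM Kprob by (intro M.integrable_const_bound[of _ 1]) (auto intro!: AE_I2 prob_space.prob_le_1)
  qed (use D gF in \<open>auto simp: M.emeasure_eq_measure\<close>)
qed

section \<open>Extended continuous mapping\<close>

text \<open>The common Lipschitz constant transfers convergence from a finite
  \<open>e / 3\<close>-net to the whole compact set.\<close>

lemma uniform_limit_if_equi_lipschitz:
  fixes f :: "nat \<Rightarrow> 'a::euclidean_space \<Rightarrow> real"
  assumes lip: "\<And>n x y. \<bar>f n x - f n y\<bar> \<le> dist x y"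
      "\<And>x y. \<bar>g x - g y\<bar> \<le> dist x y"
    and lim: "\<And>x. (\<lambda>n. f n x) \<longlonglongrightarrow> g x" and C: "compact C"
  shows "uniform_limit C f g sequentially"
proof (rule uniform_limitI)
  fix e :: real assume e: "e > 0"
  have "C \<subseteq> (\<Union>c\<in>C. ball c (e / 3))" using e by auto
  then obtain D where D: "D \<subseteq> C" "finite D" "C \<subseteq> (\<Union>c\<in>D. ball c (e / 3))"
    using compactE_image[OF C, of C "\<lambda>c. ball c (e / 3)"] by auto
  have "\<forall>\<^sub>F n in sequentially. \<forall>c\<in>D. \<bar>f n c - g c\<bar> < e / 3"
    using D(2) e tendstoD[OF lim, of "e / 3"]
    by (intro eventually_ball_finite) (auto simp: dist_real_def)
  then show "\<forall>\<^sub>F n in sequentially. \<forall>x\<in>C. dist (f n x) (g x) < e"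
  proof eventually_elim
    case (elim n)
    show ?case
    proof
      fix x assume "x \<in> C"
      then obtain c where c: "c \<in> D" "dist x c < e / 3" using D(3) by (auto simp: dist_commute)
      then show "dist (f n x) (g x) < e"
        using bspec[OF elim c(1)] lip(1)[of n x c] lip(2)[of x c] unfolding dist_real_def by linarith
    qed
  qed
qed

text \<open>The radius depends only on the limit law and on \<open>e\<close>, so that a single
  \<open>r\<close> serves for the conditional laws at almost every \<open>\<omega>\<close>.\<close>

lemma conv_in_law_tight:
  fixes \<nu> :: "'a::euclidean_space measure"
  assumes \<nu>: "prob_space \<nu>" "sets \<nu> = sets borel" and e: "0 < e"
  obtains r where "\<And>\<mu>. (\<And>n. prob_space (\<mu> n))
      \<Longrightarrow> (\<And>n. sets (\<mu> n) = sets borel) \<Longrightarrow>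
    conv_in_law \<mu> \<nu> \<Longrightarrow> \<forall>\<^sub>F n in sequentially. measure (\<mu>
        n) {w. r < norm w} < e"
proof -
  interpret \<nu>: prob_space \<nu> by (rule \<nu>(1))
  note [measurable_cong] = \<nu>(2)
  \<comment> \<open>A continuous ramp, 0 up to radius \<open>r\<close> and 1 from radius
    \<open>r + 1\<close> on. It dominates the indicator of the tail beyond \<open>r + 1\<close>,
    which is the radius finally returned.\<close>
  define p where "p r w = min 1 (max 0 (norm w - r))" for r and w :: 'a
  have p01: "0 \<le> p r w" "p r w \<le> 1" for r w by (auto simp: p_def)
  have pc: "continuous_on UNIV (p r)" for r unfolding p_def by (intro continuous_intros)
  have [measurable]: "p r \<in> borel_measurable borel" for r
    by (rule borel_measurable_continuous_onI[OF pc])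
  have "(\<lambda>k. \<integral>w. p (real k) w \<partial>\<nu>)
      \<longlonglongrightarrow> (\<integral>w. 0 \<partial>\<nu>)"
  proof (rule integral_dominated_convergence[where w = "\<lambda>_. 1"])
    show "AE w in \<nu>. (\<lambda>k. p (real k) w) \<longlonglongrightarrow> 0"
    proof (rule AE_I2)
      fix w :: 'a
      have "\<forall>\<^sub>F k in sequentially. norm w \<le> real k"
        using filterlim_real_sequentially by (simp add: filterlim_at_top)
      then have "\<forall>\<^sub>F k in sequentially. p (real k) w = 0"
        by eventually_elim (simp add: p_def)
      then show "(\<lambda>k. p (real k) w) \<longlonglongrightarrow> 0" by (rule tendsto_eventually)
    qed
  qed (use p01 in auto)
  then have "\<forall>\<^sub>F k in sequentially. (\<integral>w. p (real k) w \<partial>\<nu>) < e"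
    using e by (intro order_tendstoD) auto
  then obtain r where r: "(\<integral>w. p r w \<partial>\<nu>) < e"
    by (auto simp: eventually_sequentially)
  have "\<forall>\<^sub>F n in sequentially. measure (\<mu> n) {w. r + 1 < norm w} < e"
    if \<mu>: "\<And>n. prob_space (\<mu> n)" "\<And>n. sets (\<mu> n) = sets borel"
        and conv: "conv_in_law \<mu> \<nu>" for \<mu>
  proof -
    interpret \<mu>: prob_space "\<mu> n" for n by (rule \<mu>(1))
    note [measurable_cong] = \<mu>(2)
    have sp: "space (\<mu> n) = UNIV" for n
      using sets_eq_imp_space_eq[OF \<mu>(2)] by auto
    have "bounded (range (p r))"
      by (rule boundedI[of _ 1]) (auto simp: p01)
    then have "(\<lambda>n. \<integral>w. p r w \<partial>\<mu> n)
        \<longlonglongrightarrow> (\<integral>w. p r w \<partial>\<nu>)"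
      using conv pc unfolding conv_in_law_def by blast
    then have "\<forall>\<^sub>F n in sequentially. (\<integral>w. p r w \<partial>\<mu> n) < e"
      using r by (rule order_tendstoD)
    then show ?thesis
    proof eventually_elim
      case (elim n)
      have "measure (\<mu> n) {w. r + 1 < norm w}
          = (\<integral>w. indicat_real {w. r + 1 < norm w} w \<partial>\<mu> n)"
        using sp by simp
      also have "\<dots> \<le> (\<integral>w. p r w \<partial>\<mu> n)"
        by (intro integral_mono \<mu>.integrable_const_bound[of _ 1])
          (use p01 in \<open>auto simp: indicator_def p_def\<close>)
      finally show ?case using elim by simp
    qed
  qed
  then show ?thesis by (rule that)
qed

text \<open>On a large ball uniform convergence replaces \<open>h n\<close> by \<open>g\<close>, and
  tightness controls the rest. The images then converge in law, and absence of an atom at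
  \<open>x\<close> gives convergence of the distribution functions there.\<close>

lemma extended_continuous_mapping:
  fixes \<mu> :: "nat \<Rightarrow> 'a::euclidean_space measure"
      and h :: "nat \<Rightarrow> 'a \<Rightarrow> real"
  assumes \<mu>: "\<And>n. prob_space (\<mu> n)" "\<And>n. sets (\<mu> n) = sets borel"
    and \<nu>: "prob_space \<nu>" "sets \<nu> = sets borel"
    and conv: "conv_in_law \<mu> \<nu>"
    and h: "\<And>n. h n \<in> borel_measurable borel" and g: "continuous_on UNIV g"
    and unif: "\<And>r. uniform_limit (cball 0 r) h g sequentially"
    and no_atom: "measure \<nu> {w. g w = x} = (0::real)"
  shows "(\<lambda>n. measure (\<mu> n) {w. h n w \<le> x})
      \<longlonglongrightarrow> measure \<nu> {w. g w \<le> x}"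
proof -
  interpret \<mu>: prob_space "\<mu> n" for n by (rule \<mu>(1))
  interpret \<nu>: prob_space \<nu> by (rule \<nu>(1))
  note [measurable_cong] = \<mu>(2) \<nu>(2)
  note [measurable] = h borel_measurable_continuous_onI[OF g]
  have sp: "space (\<mu> n) = UNIV" "space \<nu> = UNIV" for n
    using sets_eq_imp_space_eq[OF \<mu>(2)] sets_eq_imp_space_eq[OF \<nu>(2)] by auto
  have conv01: "(\<lambda>n. \<integral>w. f w \<partial>\<mu> n)
      \<longlonglongrightarrow> (\<integral>w. f w \<partial>\<nu>)"
    if "continuous_on UNIV f" "\<And>w. 0 \<le> f w" "\<And>w. f w \<le> 1" for f :: "'a \<Rightarrow> real"
  proof -
    have "bounded (range f)"
      by (rule boundedI[of _ 1]) (auto simp: that)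
    with conv that(1) show ?thesis unfolding conv_in_law_def by blast
  qed
  interpret H: real_distribution "distr (\<mu> n) borel (h n)" for n
    by (rule \<mu>.real_distribution_distr) simp
  interpret G: real_distribution "distr \<nu> borel g"
    by (rule \<nu>.real_distribution_distr) simp
  have "weak_conv_m (\<lambda>n. distr (\<mu> n) borel (h n)) (distr \<nu> borel g)"
  proof (rule integral_cts_step_conv_imp_weak_conv)
    show "real_distribution (distr (\<mu> n) borel (h n))" for n by (rule H.real_distribution_axioms)
    show "real_distribution (distr \<nu> borel g)" by (rule G.real_distribution_axioms)
    fix a b :: real assume ab: "a < b"
    let ?f = "cts_step a b"
    \<comment> \<open>Uniform continuity of the test function turns closeness of \<open>h n\<close>
      and \<open>g\<close> on a ball into closeness of the integrands.\<close>
    have uc: "uniformly_continuous_on UNIV ?f" by (rule cts_step_uniformly_continuous[OF ab])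
    then have fc: "continuous_on UNIV ?f" by (rule uniformly_continuous_imp_continuous)
    note [measurable] = borel_measurable_continuous_onI[OF fc]
    have f01: "0 \<le> ?f t" "?f t \<le> 1" for t
      using ab by (auto simp: cts_step_def field_simps)
    have int: "integrable (\<mu> n) (\<lambda>w. ?f (h n w))"
        "integrable (\<mu> n) (\<lambda>w. ?f (g w))" for n
      by (rule \<mu>.integrable_const_bound[of _ 1]; use f01 in auto)+
    have "(\<lambda>n. \<integral>w. ?f (h n w) \<partial>\<mu> n)
        \<longlonglongrightarrow> (\<integral>w. ?f (g w) \<partial>\<nu>)"
    proof (rule tendstoI)
      fix e :: real assume e: "e > 0"
      obtain d where d: "d > 0" "\<And>s t. dist s t < d \<Longrightarrow> dist (?f s) (?f t) < e / 4"
        using uc e unfolding uniformly_continuous_on_def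
        by (metis UNIV_I divide_pos_pos zero_less_numeral)
      obtain r where 1: "\<forall>\<^sub>F n in sequentially. measure (\<mu> n) {w. r < norm w} < e / 4"
        using conv_in_law_tight[OF \<nu>, of "e / 4"] e \<mu> conv
            by (metis divide_pos_pos zero_less_numeral)
      have "continuous_on UNIV (\<lambda>w. ?f (g w))"
        by (rule continuous_on_compose2[OF fc g]) simp
      from conv01[OF this f01] have "(\<lambda>n. \<integral>w. ?f (g w) \<partial>\<mu> n)
          \<longlonglongrightarrow> (\<integral>w. ?f (g w) \<partial>\<nu>)" .
      then have 2: "\<forall>\<^sub>F n in sequentially. dist (\<integral>w. ?f (g w)
          \<partial>\<mu> n) (\<integral>w. ?f (g w) \<partial>\<nu>) < e / 4"
        using e by (intro tendstoD) auto
      have 3: "\<forall>\<^sub>F n in sequentially. \<forall>w\<in>cball 0 r. dist (h n w) (g w) < d"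
        using uniform_limitD[OF unif d(1)] .
      show "\<forall>\<^sub>F n in sequentially. dist (\<integral>w. ?f (h n w) \<partial>\<mu> n)
          (\<integral>w. ?f (g w) \<partial>\<nu>) < e"
        using 1 2 3
      proof eventually_elim
        case (elim n)
        \<comment> \<open>The integrands differ by at most \<open>e / 4\<close> on the ball and by
          at most 1 off it. Tail mass and the error for the fixed function \<open>g\<close> are each
          below \<open>e / 4\<close>, which gives a total below \<open>e\<close>.\<close>
        have bound: "\<bar>?f (h n w) - ?f (g w)\<bar> \<le> e / 4 + indicat_real {w. r < norm w} w" for w
        proof (cases "norm w \<le> r")
          case True
          then have "dist (?f (h n w)) (?f (g w)) < e / 4" using elim(3) d(2) by simp
          then show ?thesis using True by (simp add: dist_real_def)
        next
          case False
          then show ?thesis using f01[of "h n w"] f01[of "g w"] e by (simp add: abs_le_iff)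
        qed
        have ind: "integrable (\<mu> n) (indicat_real {w. r < norm w})"
          by (rule \<mu>.integrable_const_bound[of _ 1]) auto
        have "\<bar>(\<integral>w. ?f (h n w) \<partial>\<mu> n) - (\<integral>w. ?f (g w)
            \<partial>\<mu> n)\<bar> \<le> (\<integral>w. \<bar>?f (h n w) - ?f (g w)\<bar>
            \<partial>\<mu> n)"
          using int[of n] by (simp add: integral_abs_bound flip: Bochner_Integration.integral_diff)
        also have "\<dots> \<le> (\<integral>w. e / 4 + indicat_real {w. r < norm w} w \<partial>\<mu> n)"
          using int[of n] ind bound by (intro integral_mono) auto
        also have "\<dots> = e / 4 + measure (\<mu> n) {w. r < norm w}"
          using ind \<mu>.prob_space[of n] by (simp add: sp)
        finally show ?case using elim(1,2) e unfolding dist_real_def by linarith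
      qed
    qed
    then show "(\<lambda>n. integral\<^sup>L (distr (\<mu> n) borel (h n)) ?f)
        \<longlonglongrightarrow> integral\<^sup>L (distr \<nu> borel g) ?f"
      by (simp add: integral_distr)
  qed
  moreover have "isCont (cdf (distr \<nu> borel g)) x"
    unfolding G.isCont_cdf using no_atom by (simp add: measure_distr sp vimage_def)
  ultimately have "(\<lambda>n. cdf (distr (\<mu> n) borel (h n)) x)
      \<longlonglongrightarrow> cdf (distr \<nu> borel g) x"
    by (simp add: weak_conv_m_def weak_conv_def)
  then show ?thesis
    by (simp add: cdf_def measure_distr sp vimage_def)
qed

section \<open>The bootstrap test\<close>

lemma subspace_tangent_space: "subspace (tangent_space (A :: real^'h^'p))"
  by (auto simp: subspace_def tangent_space_iff matrix_vector_mult_add_rdistrib inner_right_distrib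
      scaleR_matrix_vector_assoc[symmetric])

text \<open>With \<open>t n = 1 / sqrt n\<close> the scaled distances are 1-Lipschitz in
  \<open>w\<close>, so their pointwise convergence is uniform on balls; squaring preserves this
  because the limit is bounded there.\<close>

lemma scaled_infdist_uniform_limit:
  fixes A :: "real^'h^'p"
  assumes B: "B \<longlonglongrightarrow> A" "\<And>n. rank (B n) \<le> rank A"
  shows "uniform_limit (cball 0 r)
    (\<lambda>n w. real n * (infdist (B n + (1 / sqrt (real n)) *\<^sub>R w) {C. rank C
        \<le> rank A})\<^sup>2)
    (\<lambda>w. (infdist w (tangent_space A))\<^sup>2) sequentially"
proof -
  let ?R = "{C::real^'h^'p. rank C \<le> rank A}" and ?T = "tangent_space A"
  let ?d = "\<lambda>n w. sqrt (real n) * infdist (B n + (1 / sqrt (real n)) *\<^sub>R w) ?R"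
  have lim: "(\<lambda>n. ?d n w) \<longlonglongrightarrow> infdist w ?T" for w
  proof -
    \<comment> \<open>The shift to \<open>Suc n\<close> avoids index 0, at which the scale
      \<open>1 / sqrt 0\<close> is 0 and not positive.\<close>
    have "(\<lambda>n. infdist (B (Suc n) + (1 / sqrt (real (Suc n))) *\<^sub>R w) ?R / (1 / sqrt
        (real (Suc n)))) \<longlonglongrightarrow> infdist w ?T"
    proof (rule infdist_rank_le_tendsto)
      show "(\<lambda>n. B (Suc n)) \<longlonglongrightarrow> A" using B(1) by (rule LIMSEQ_Suc)
      show "(\<lambda>n. 1 / sqrt (real (Suc n))) \<longlonglongrightarrow> 0"
        using LIMSEQ_Suc[OF tendsto_inverse_0_at_top[OF filterlim_compose[OF sqrt_at_top
            filterlim_real_sequentially]]]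
        by (simp add: inverse_eq_divide)
    qed (use B in auto)
    then have "(\<lambda>n. ?d (Suc n) w) \<longlonglongrightarrow> infdist w ?T"
      by (simp add: mult.commute)
    then show ?thesis by (rule LIMSEQ_imp_Suc)
  qed
  have "\<bar>?d n x - ?d n y\<bar> \<le> dist x y" for n x y
  proof -
    have "\<bar>?d n x - ?d n y\<bar> = sqrt (real n) * \<bar>infdist (B n + (1 / sqrt (real n))
        *\<^sub>R x) ?R - infdist (B n + (1 / sqrt (real n)) *\<^sub>R y) ?R\<bar>"
      by (simp add: right_diff_distrib[symmetric] abs_mult)
    also have "\<dots> \<le> sqrt (real n) * dist (B n + (1 / sqrt (real n)) *\<^sub>R x) (B n + (1
        / sqrt (real n)) *\<^sub>R y)"
      by (intro mult_left_mono infdist_triangle_abs) simp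
    also have "\<dots> \<le> dist x y"
      by (cases "n = 0") (simp_all add: dist_norm flip: scaleR_diff_right)
    finally show ?thesis .
  qed
  then have u: "uniform_limit (cball 0 r) ?d (\<lambda>w. infdist w ?T) sequentially"
    using lim by (intro uniform_limit_if_equi_lipschitz infdist_triangle_abs compact_cball)
  have "bounded ((\<lambda>w. infdist w ?T) ` cball 0 r)"
    by (intro compact_imp_bounded compact_continuous_image continuous_intros compact_cball)
  then have "uniform_limit (cball 0 r) (\<lambda>n w. ?d n w * ?d n w) (\<lambda>w. infdist w ?T *
      infdist w ?T) sequentially"
    by (intro uniform_lim_mult u)
  moreover have "?d n w * ?d n w = real n * (infdist (B n + (1 / sqrt (real n)) *\<^sub>R w)
      ?R)\<^sup>2" for n w
    by (simp add: power2_eq_square algebra_simps)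
  ultimately show ?thesis by (simp add: power2_eq_square)
qed

section \<open>Measurability, and the conditional law of a function of sample and noise\<close>

lemma borel_measurable_matrix_mult [measurable (raw)]:
  fixes f :: "'a \<Rightarrow> real^'h^'p" and g :: "'a \<Rightarrow> real^'k^'h"
  assumes "f \<in> borel_measurable M" "g \<in> borel_measurable M"
  shows "(\<lambda>x. f x ** g x) \<in> borel_measurable M"
  using assms
proof (rule borel_measurable_continuous_Pair)
  show "continuous_on UNIV (\<lambda>z. fst z ** (snd z :: real^'k^'h) :: real^'k^'p)"
    unfolding continuous_on_def by (intro ballI tendsto_matrix_mult tendsto_intros)
qed

lemma borel_measurable_infdist [measurable (raw)]:
  fixes f :: "'a \<Rightarrow> 'b::euclidean_space"
  assumes "f \<in> borel_measurable M"
  shows "(\<lambda>x. infdist (f x) S) \<in> borel_measurable M"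
  using assms by (rule measurable_compose) (intro borel_measurable_continuous_onI continuous_intros)

text \<open>Both sides are versions of the conditional probability of the event
  \<open>L \<omega> \<le> x\<close>, the right one by freezing \<open>B\<close>. The exceptional
  null set may depend on \<open>x\<close>.\<close>

lemma cond_law_pushforward_cdf:
  fixes X :: "'a \<Rightarrow> 'b::second_countable_topology"
      and B :: "'a \<Rightarrow> 'c::second_countable_topology"
  assumes M: "prob_space M" and F: "subalgebra M F" and X: "X \<in> borel_measurable M"
    and KX: "is_cond_law M F X KX" and B: "B \<in> borel_measurable F"
    and L: "\<And>\<omega>. \<omega> \<in> space M \<Longrightarrow> L \<omega>
        = f (B \<omega>) (X \<omega>)" and KL: "is_cond_law M F L KL"
    and f: "(\<lambda>z. f (fst z) (snd z)) \<in> borel_measurable (borel \<Otimes>\<^sub>M borel)"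
  shows "AE \<omega> in M. measure (KL \<omega>) {..x::real}
      = measure (KX \<omega>) {w. f (B \<omega>) w \<le> x}"
proof -
  have space: "space F = space M" using F by (simp add: subalgebra_def)
  let ?S = "{z \<in> space (F \<Otimes>\<^sub>M borel). f (B (fst z)) (snd z) \<le> x}"
  have "(\<lambda>z. f (B (fst z)) (snd z)) \<in> borel_measurable (F \<Otimes>\<^sub>M borel)"
    using measurable_compose[OF _ f, of "\<lambda>z. (B (fst z), snd z)"
        "F \<Otimes>\<^sub>M borel"] B by simp
  then have S: "?S \<in> sets (F \<Otimes>\<^sub>M borel)" by measurable
  have "L -` {..x} \<inter> space M = {\<omega>\<in>space M. (\<omega>, X \<omega>) \<in> ?S}"
    using L by (auto simp: space_pair_measure space)
  then have "AE \<omega> in M. measure (KL \<omega>) {..x}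
      = real_cond_exp M F (indicat_real {\<omega>\<in>space M. (\<omega>, X \<omega>) \<in> ?S}) \<omega>"
    using KL unfolding is_cond_law_def by (metis atMost_borel)
  with cond_law_joint[OF M F X KX S] AE_space show ?thesis
  proof eventually_elim
    case (elim \<omega>)
    then have "Pair \<omega> -` ?S = {w. f (B \<omega>) w \<le> x}"
      by (auto simp: space_pair_measure space)
    with elim show ?case by simp
  qed
qed

text \<open>Dominated convergence for the indicators of the events.\<close>

lemma measure_tendsto_0_if_AE_eventually_notin:
  assumes "prob_space M" and D: "\<And>n. D n \<in> sets M"
    and AE: "AE \<omega> in M. \<forall>\<^sub>F n in sequentially. \<omega> \<notin> D n"
  shows "(\<lambda>n. measure M (D n)) \<longlonglongrightarrow> 0"
proof -
  interpret prob_space M by fact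
  note [measurable] = D
  have "(\<lambda>n. \<integral>\<omega>. indicat_real (D n) \<omega> \<partial>M)
      \<longlonglongrightarrow> (\<integral>\<omega>. 0 \<partial>M)"
  proof (rule integral_dominated_convergence[where w = "\<lambda>_. 1"])
    show "AE \<omega> in M. (\<lambda>n. indicat_real (D n) \<omega>) \<longlonglongrightarrow> 0"
      using AE
    proof eventually_elim
      case (elim \<omega>)
      then show ?case by (intro tendsto_eventually) (auto elim: eventually_mono)
    qed
  qed (auto simp: indicator_def)
  then show ?thesis using sets.sets_into_space[OF D] by (simp add: Int_absorb2)
qed

lemma real_distribution_cdf_attains:
  assumes "real_distribution \<nu>" and cont: "\<And>x. isCont (cdf \<nu>) x" and y: "0 < y" "y < 1"
  obtains x where "cdf \<nu> x = y"
proof -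
  interpret real_distribution \<nu> by fact
  obtain l where l: "cdf \<nu> l < y"
    using order_tendstoD(2)[OF cdf_lim_at_bot y(1)] by (auto simp: eventually_at_bot_linorder)
  obtain u where u: "y < cdf \<nu> u"
    using order_tendstoD(1)[OF cdf_lim_at_top_prob y(2)] by (auto simp: eventually_at_top_linorder)
  have "l \<le> u" using l u cdf_nondecreasing[of u l] by linarith
  then show ?thesis
    using IVT[of "cdf \<nu>" l y u] l u cont that by auto
qed

text \<open>Fixed points at which the limiting distribution function is slightly below or above
  \<open>\<alpha>\<close> bound the random quantile, almost surely for large \<open>n\<close>.
  Comparing \<open>L n\<close> with these points gives the two bounds, also when the quantile of the
  limit law is not unique.\<close>

lemma bootstrap_level:
  assumes M: "prob_space M" and L: "\<And>n. L n \<in> borel_measurable M"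
    and K: "\<And>n. K n \<in> measurable M (prob_algebra borel)"
    and \<nu>: "real_distribution \<nu>" "\<And>x. isCont (cdf \<nu>) x"
    and lim: "\<And>x. (\<lambda>n. measure M {\<omega>\<in>space M. L n \<omega>
        \<le> x}) \<longlonglongrightarrow> cdf \<nu> x"
    and limK: "\<And>x. AE \<omega> in M. (\<lambda>n. cdf (K n \<omega>) x)
        \<longlonglongrightarrow> cdf \<nu> x"
    and \<alpha>: "0 < \<alpha>" "\<alpha> < 1"
  shows "(\<lambda>n. measure M {\<omega>\<in>space M. L n \<omega> > quantile (K n \<omega>)
      \<alpha>}) \<longlonglongrightarrow> 1 - \<alpha>"
proof -
  interpret prob_space M by fact
  interpret \<nu>: real_distribution \<nu> by fact
  let ?q = "\<lambda>n \<omega>. quantile (K n \<omega>) \<alpha>"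
  note [measurable] = L borel_measurable_quantile[OF K \<alpha>]
  note q_le = quantile_le_iff[OF prob_algebra_borelD[OF K] \<alpha>]
  let ?R = "\<lambda>n. {\<omega>\<in>space M. L n \<omega> > ?q n \<omega>}" and ?U
      = "\<lambda>n x. {\<omega>\<in>space M. L n \<omega> > x}"
  have limU: "(\<lambda>n. prob (?U n x)) \<longlonglongrightarrow> 1 - cdf \<nu> x" for x
  proof -
    have "?U n x = space M - {\<omega>\<in>space M. L n \<omega> \<le> x}" for n by auto
    then have "prob (?U n x) = 1 - prob {\<omega>\<in>space M. L n \<omega> \<le> x}" for n
      by (simp only:) (rule prob_compl, measurable)
    then show ?thesis by (simp only:) (intro tendsto_intros lim)
  qed
  show ?thesis
  proof (rule order_tendstoI)
    fix c assume c: "1 - \<alpha> < c"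
    \<comment> \<open>The second entry of the maximum is the midpoint of \<open>1 - c\<close> and
      \<open>\<alpha>\<close>; the first keeps the value positive.\<close>
    obtain a where a: "cdf \<nu> a = max (\<alpha> / 2) (1 - c / 2 - (1 - \<alpha>) / 2)"
      by (rule real_distribution_cdf_attains[OF \<nu>, of "max (\<alpha> / 2) (1 - c / 2 - (1 -
          \<alpha>) / 2)"])
        (use \<alpha> c in \<open>auto simp: max_def field_simps\<close>)
    then have a1: "cdf \<nu> a < \<alpha>" "1 - cdf \<nu> a < c"
      using \<alpha> c by (auto simp: max_def field_simps split: if_splits)
    have "(\<lambda>n. prob {\<omega>\<in>space M. ?q n \<omega> \<le> a}) \<longlonglongrightarrow> 0"
    proof (rule measure_tendsto_0_if_AE_eventually_notin[OF M])
      show "AE \<omega> in M. \<forall>\<^sub>F n in sequentially. \<omega> \<notin> {\<omega>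
          \<in> space M. ?q n \<omega> \<le> a}"
        using limK[of a] AE_space
      proof eventually_elim
        case (elim \<omega>)
        then show ?case
          using order_tendstoD(2)[OF elim(1) a1(1)]
          by (auto elim!: eventually_mono simp: q_le not_le)
      qed
    qed measurable
    from tendsto_add[OF limU[of a] this]
    have "\<forall>\<^sub>F n in sequentially. prob (?U n a) + prob {\<omega>\<in>space M. ?q n
        \<omega> \<le> a} < c"
      using a1(2) by (intro order_tendstoD) auto
    then show "\<forall>\<^sub>F n in sequentially. prob (?R n) < c"
    proof eventually_elim
      case (elim n)
      \<comment> \<open>Where the quantile exceeds \<open>a\<close>, rejection implies
        \<open>L n \<omega> > a\<close>.\<close>
      have "prob (?R n) \<le> prob (?U n a \<union> {\<omega>\<in>space M. ?q n \<omega> \<le> a})"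
        by (intro finite_measure_mono) (auto, measurable)
      also have "\<dots> \<le> prob (?U n a) + prob {\<omega>\<in>space M. ?q n \<omega> \<le> a}"
        by (intro measure_Un_le) measurable
      finally show ?case using elim by simp
    qed
  next
    fix c assume c: "c < 1 - \<alpha>"
    \<comment> \<open>The midpoint of \<open>\<alpha>\<close> and \<open>1 - c\<close>, capped by
      \<open>(1 + \<alpha>) / 2\<close> so that it stays below 1.\<close>
    obtain b where b: "cdf \<nu> b = min ((1 + \<alpha>) / 2) ((1 - c + \<alpha>) / 2)"
      by (rule real_distribution_cdf_attains[OF \<nu>, of "min ((1 + \<alpha>) / 2) ((1 - c +
          \<alpha>) / 2)"])
        (use \<alpha> c in \<open>auto simp: min_def field_simps\<close>)
    then have b1: "\<alpha> < cdf \<nu> b" "c < 1 - cdf \<nu> b"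
      using \<alpha> c by (auto simp: min_def field_simps split: if_splits)
    have "(\<lambda>n. prob {\<omega>\<in>space M. b < ?q n \<omega>}) \<longlonglongrightarrow> 0"
    proof (rule measure_tendsto_0_if_AE_eventually_notin[OF M])
      show "AE \<omega> in M. \<forall>\<^sub>F n in sequentially. \<omega> \<notin> {\<omega>
          \<in> space M. b < ?q n \<omega>}"
        using limK[of b] AE_space
      proof eventually_elim
        case (elim \<omega>)
        then show ?case
          using order_tendstoD(1)[OF elim(1) b1(1)]
          by (auto elim!: eventually_mono simp: q_le not_less less_imp_le)
      qed
    qed measurable
    from tendsto_diff[OF limU[of b] this]
    have "\<forall>\<^sub>F n in sequentially. c < prob (?U n b) - prob {\<omega>\<in>space M. b <
        ?q n \<omega>}"
      using b1(2) by (intro order_tendstoD) auto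
    then show "\<forall>\<^sub>F n in sequentially. c < prob (?R n)"
    proof eventually_elim
      case (elim n)
      \<comment> \<open>Where the quantile is at most \<open>b\<close>, the event
        \<open>L n \<omega> > b\<close> implies rejection.\<close>
      have "prob (?U n b) \<le> prob (?R n \<union> {\<omega>\<in>space M. b < ?q n \<omega>})"
        by (intro finite_measure_mono) (auto, measurable)
      also have "\<dots> \<le> prob (?R n) + prob {\<omega>\<in>space M. b < ?q n \<omega>}"
        by (intro measure_Un_le) measurable
      finally show ?case using elim by simp
    qed
  qed
qed

theorem proposition7:
  fixes M :: "'a measure" and F :: "nat \<Rightarrow> 'a measure"
    and N :: "'c measure" and W :: "'c \<Rightarrow> real^'h^'p"
    and \<Gamma> :: "real^('h \<times> 'p)^('h \<times> 'p)"
    and M0 :: "real^'h^'p" and m :: nat and \<alpha> :: real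
    and Mhat Wstar Mstar :: "nat \<Rightarrow> 'a \<Rightarrow> real^'h^'p"
    and P1 :: "nat \<Rightarrow> 'a \<Rightarrow> real^'p^'p" and P2 :: "nat \<Rightarrow> 'a \<Rightarrow> real^'h^'h"
    and lamhat lamstar :: "nat \<Rightarrow> 'a \<Rightarrow> nat \<Rightarrow> real"
    and Lamhat Lamstar :: "nat \<Rightarrow> 'a \<Rightarrow> real"
    and KW :: "nat \<Rightarrow> 'a \<Rightarrow> (real^'h^'p) measure"
    and KL :: "nat \<Rightarrow> 'a \<Rightarrow> real measure"
  assumes dims: "CARD('p) \<le> CARD('h)" "m \<in> {1..CARD('p)}"
    and prob: "prob_space M"
    \<comment> \<open>\<open>F n\<close> is the sigma-algebra generated by the sample of size \<open>n\<close>\<close>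
    and sample: "\<And>n. subalgebra M (F n)"
    and limit: "prob_space N" "W \<in> borel_measurable N"
      "is_centered_gaussian (distr N borel (\<lambda>x. vec_cols (W x))) \<Gamma>"
    and Mhat_sample: "\<And>n. Mhat n \<in> borel_measurable (F n)"
    and Mhat_law: "conv_in_law (\<lambda>n. distr M borel (\<lambda>\<omega>. sqrt (real n) *\<^sub>R (Mhat n \<omega> - M0)))
                     (distr N borel W)"
    and Mhat_as: "AE \<omega> in M. (\<lambda>n. Mhat n \<omega>) \<longlonglongrightarrow> M0"
    and projectors: "\<And>n \<omega>. \<omega> \<in> space M \<Longrightarrow>
                       are_leading_projectors m (Mhat n \<omega>) (P1 n \<omega>) (P2 n \<omega>)"
    and projectors_sample:
      "\<And>n. P1 n \<in> borel_measurable (F n)" "\<And>n. P2 n \<in> borel_measurable (F n)"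
    and Wstar_meas: "\<And>n. Wstar n \<in> borel_measurable M"
    and Wstar_cond: "\<And>n. is_cond_law M (F n) (Wstar n) (KW n)"
    and Wstar_law: "AE \<omega> in M. conv_in_law (\<lambda>n. KW n \<omega>) (distr N borel W)"
    and Mstar: "\<And>n \<omega>. Mstar n \<omega> =
                  P1 n \<omega> ** Mhat n \<omega> ** P2 n \<omega> + (1 / sqrt (real n)) *\<^sub>R Wstar n \<omega>"
    and lamhat: "\<And>n \<omega>. \<omega> \<in> space M \<Longrightarrow> are_singular_values (Mhat n \<omega>) (lamhat n \<omega>)"
    and lamstar: "\<And>n \<omega>. \<omega> \<in> space M \<Longrightarrow> are_singular_values (Mstar n \<omega>) (lamstar n \<omega>)"
    and Lamhat: "\<And>n \<omega>. Lamhat n \<omega> = real n * (\<Sum>k=m+1..CARD('p). (lamhat n \<omega> k)\<^sup>2)"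
    and Lamstar: "\<And>n \<omega>. Lamstar n \<omega> = real n * (\<Sum>k=m+1..CARD('p). (lamstar n \<omega> k)\<^sup>2)"
    and Lamstar_cond: "\<And>n. is_cond_law M (F n) (Lamstar n) (KL n)"
    and level: "0 < \<alpha>" "\<alpha> < 1"
    \<comment> \<open>under the null hypothesis the limit law of \<open>Lamhat\<close> is not the point mass at 0\<close>
    and nondegenerate: "rank M0 = m \<Longrightarrow> nondegenerate_on_kernels M0 N W"
  shows "(rank M0 = m \<longrightarrow>
            (\<lambda>n. measure M {\<omega> \<in> space M. Lamhat n \<omega> > quantile (KL n \<omega>) \<alpha>})
              \<longlonglongrightarrow> 1 - \<alpha>) \<and>
         (rank M0 > m \<longrightarrow>
            (\<lambda>n. measure M {\<omega> \<in> space M. Lamhat n \<omega> > quantile (KL n \<omega>) \<alpha>})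
              \<longlonglongrightarrow> 1)"
proof -
  let ?R = "{C::real^'h^'p. rank C \<le> m}"
  interpret M: prob_space M by fact
  interpret N: prob_space N by (rule limit(1))
  have FM: "f \<in> borel_measurable M" if "f \<in> borel_measurable (F n)" for f :: "'a
      \<Rightarrow> real^'h^'p" and n
    using sample that by (rule measurable_from_subalg)
  note Mhat_meas [measurable] = FM[OF Mhat_sample]
  define \<nu> where "\<nu> = distr N borel W"
  have \<nu>: "prob_space \<nu>" "sets \<nu> = sets borel"
    unfolding \<nu>_def using limit(2) by (simp_all add: N.prob_space_distr)
  have KLF: "KL n \<in> measurable (F n) (prob_algebra borel)"
      and KWF: "KW n \<in> measurable (F n) (prob_algebra borel)" for n
    using Lamstar_cond[of n] Wstar_cond[of n] by (auto simp: is_cond_law_def)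
  have KLM: "KL n \<in> measurable M (prob_algebra borel)"
      and KWM: "KW n \<in> measurable M (prob_algebra borel)" for n
    using measurable_from_subalg[OF sample KLF] measurable_from_subalg[OF sample KWF] by auto
  note KW = prob_algebra_borelD[OF KWM]
  \<comment> \<open>The statistic as a function of a centre \<open>B\<close> and a noise
    \<open>w\<close>. For \<open>n > 0\<close> the sample version has centre \<open>M0\<close> and
    noise \<open>sqrt n (Mhat - M0)\<close>; the bootstrap version has centre
    \<open>P1 ** Mhat ** P2\<close> and noise \<open>Wstar\<close>.\<close>
  define f where "f n B w = real n * (infdist (B + (1 / sqrt (real n)) *\<^sub>R w) ?R)\<^sup>2"
      for n and B w :: "real^'h^'p"
  have f_meas: "(\<lambda>z. f n (fst z) (snd z)) \<in> borel_measurable (borel \<Otimes>\<^sub>M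
      borel)" for n
    unfolding f_def by measurable
  have f_meas1: "f n B \<in> borel_measurable borel" for n B
    unfolding f_def by measurable
  have Lamhat_eq: "Lamhat n \<omega> = real n * (infdist (Mhat n \<omega>) ?R)\<^sup>2" if
      "\<omega> \<in> space M" for n \<omega>
    using singular_values_tail_eq_infdist[OF lamhat[OF that] dims(2)] by (simp add: Lamhat)
  have Lamstar_eq: "Lamstar n \<omega> = f n (P1 n \<omega> ** Mhat n \<omega> ** P2 n \<omega>)
      (Wstar n \<omega>)" if "\<omega> \<in> space M" for n \<omega>
    using singular_values_tail_eq_infdist[OF lamstar[OF that] dims(2)] by (simp add: Lamstar Mstar f_def)
  have Lamhat_meas [measurable]: "Lamhat n \<in> borel_measurable M" for n
    by (subst measurable_cong[OF Lamhat_eq]) measurable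
  note truncate = leading_projectors_truncate[OF projectors dims(2)]
  \<comment> \<open>The point \<open>x\<close> is fixed, and the null sets of the countably many
    \<open>n\<close> are merged into one.\<close>
  have cdf_KL: "AE \<omega> in M. \<forall>n. cdf (KL n \<omega>) x
      = measure (KW n \<omega>) {w. f n (P1 n \<omega> ** Mhat n \<omega> ** P2 n \<omega>) w
      \<le> x}" for x
    unfolding AE_all_countable cdf_def
  proof
    fix n
    have B: "(\<lambda>\<omega>. P1 n \<omega> ** Mhat n \<omega> ** P2 n \<omega>) \<in>
        borel_measurable (F n)"
      by (intro borel_measurable_matrix_mult projectors_sample Mhat_sample)
    show "AE \<omega> in M. measure (KL n \<omega>) {..x}
        = measure (KW n \<omega>) {w. f n (P1 n \<omega> ** Mhat n \<omega> ** P2 n \<omega>) w \<le> x}"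
      by (rule cond_law_pushforward_cdf[OF prob sample Wstar_meas Wstar_cond B Lamstar_eq
          Lamstar_cond f_meas])
  qed
  have H0: "(\<lambda>n. measure M {\<omega> \<in> space M. Lamhat n \<omega> > quantile (KL n
      \<omega>) \<alpha>}) \<longlonglongrightarrow> 1 - \<alpha>"
    if rank: "rank M0 = m"
  proof -
    let ?g = "\<lambda>w. (infdist w (tangent_space M0))\<^sup>2"
    have g: "continuous_on UNIV ?g" by (intro continuous_intros)
    note [measurable] = borel_measurable_continuous_onI[OF g] limit(2)
    obtain u v where uv: "transpose M0 *v u = 0" "M0 *v v = 0"
        "\<not> (AE x in N. u \<bullet> (W x *v v) = 0)"
      using nondegenerate[OF rank] unfolding nondegenerate_on_kernels_def by blast
    \<comment> \<open>By \<open>tangent_space_iff\<close> the matrix \<open>outer u v\<close> is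
      orthogonal to the tangent space at \<open>M0\<close>; it serves as the nondegenerate normal
      functional \<open>a\<close>.\<close>
    have uv_outer: "outer u v \<bullet> w = u \<bullet> (w *v v)" for w :: "real^'h^'p"
      by (simp add: outer_def inner_vec_def matrix_vector_mult_def sum_distrib_left mult.assoc
          mult.left_commute mult.commute)
    have atom: "measure \<nu> {w. ?g w = x} = 0" for x
    proof -
      have "measure N {y\<in>space N. ?g (W y) = x} = 0"
        by (rule gaussian_infdist_no_atom[OF limit subspace_tangent_space, where a = "outer u v"])
          (use uv in \<open>auto simp: uv_outer tangent_space_iff\<close>)
      moreover have "W -` {w. ?g w = x} \<inter> space N = {y\<in>space N. ?g (W y) = x}" by auto
      ultimately show ?thesis unfolding \<nu>_def by (subst measure_distr) auto
    qed
    let ?G = "distr \<nu> borel ?g"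
    have sp\<nu>: "space \<nu> = UNIV" using sets_eq_imp_space_eq[OF \<nu>(2)] by simp
    have g\<nu>: "?g \<in> borel_measurable \<nu>"
      using \<nu>(2) by (simp cong: measurable_cong_sets)
    have G: "real_distribution ?G"
      by (rule prob_space.real_distribution_distr[OF \<nu>(1) g\<nu>])
    interpret G: real_distribution ?G by (rule G)
    have cdfG: "cdf ?G x = measure \<nu> {w. ?g w \<le> x}" for x
      using g\<nu> by (simp add: cdf_def measure_distr sp\<nu> vimage_def)
    \<comment> \<open>Applied twice: to the unconditional laws with constant centre
      \<open>M0\<close>, and, at a fixed \<open>\<omega>\<close>, to the conditional laws with the
      truncated estimators as centres.\<close>
    have mapping: "(\<lambda>n. measure (\<mu> n) {w. f n (B n) w
        \<le> x}) \<longlonglongrightarrow> cdf ?G x"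
      if "\<And>n. prob_space (\<mu> n)" "\<And>n. sets (\<mu> n) = sets borel" "conv_in_law \<mu> \<nu>"
        "B \<longlonglongrightarrow> M0" "\<And>n. rank (B n) \<le> m" for \<mu> B x
      unfolding cdfG
    proof (rule extended_continuous_mapping[OF that(1,2) \<nu> that(3) f_meas1 g _ atom])
      show "uniform_limit (cball 0 r) (\<lambda>n. f n (B n)) ?g sequentially" for r
        using scaled_infdist_uniform_limit[OF that(4), of r] that(5) by (simp add: f_def[abs_def] rank)
    qed
    show ?thesis
    proof (rule bootstrap_level[OF prob Lamhat_meas KLM G _ _ _ level])
      show "isCont (cdf ?G) x" for x
        unfolding G.isCont_cdf using atom g\<nu> by (simp add: measure_distr sp\<nu> vimage_def)
    next
      fix x
      let ?X = "\<lambda>n \<omega>. sqrt (real n) *\<^sub>R (Mhat n \<omega> - M0)"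
      have "(\<lambda>n. measure (distr M borel (?X n)) {w. f n M0 w
          \<le> x}) \<longlonglongrightarrow> cdf ?G x"
        by (rule mapping) (use Mhat_law rank in \<open>auto simp: \<nu>_def intro!:
            M.prob_space_distr\<close>)
      \<comment> \<open>For \<open>n > 0\<close> the factors \<open>sqrt n\<close> cancel, and
        centre plus scaled noise is \<open>Mhat\<close>; at \<open>n = 0\<close> the matrix
        \<open>Mhat\<close> is not recovered.\<close>
      moreover have "\<forall>\<^sub>F n in sequentially. measure (distr M borel (?X n)) {w. f n M0
          w \<le> x}
          = measure M {\<omega>\<in>space M. Lamhat n \<omega> \<le> x}"
        using eventually_gt_at_top[of 0]
      proof eventually_elim
        case (elim n)
        have "f n M0 (?X n \<omega>) = Lamhat n \<omega>" if "\<omega> \<in> space M" for \<omega>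
          using elim that by (simp add: f_def Lamhat_eq)
        then have "?X n -` {w. f n M0 w \<le> x} \<inter> space M
            = {\<omega>\<in>space M. Lamhat n \<omega> \<le> x}" by auto
        moreover have "{w. f n M0 w \<le> x} \<in> sets borel"
          using f_meas1[of n M0] by simp
        ultimately show ?case by (subst measure_distr) simp_all
      qed
      ultimately show "(\<lambda>n. measure M {\<omega>\<in>space M. Lamhat n \<omega>
          \<le> x}) \<longlonglongrightarrow> cdf ?G x"
        by (rule Lim_transform_eventually)
    next
      fix x
      show "AE \<omega> in M. (\<lambda>n. cdf (KL n \<omega>) x) \<longlonglongrightarrow> cdf ?G x"
        using cdf_KL[of x] Wstar_law Mhat_as AE_space
      proof eventually_elim
        case (elim \<omega>)
        let ?B = "\<lambda>n. P1 n \<omega> ** Mhat n \<omega> ** P2 n \<omega>"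
        \<comment> \<open>Under the null hypothesis \<open>M0\<close> lies in \<open>?R\<close>, so
          the truncation error, which is the distance of \<open>Mhat\<close> to \<open>?R\<close>,
          tends to 0 and the bootstrap centres converge to \<open>M0\<close>.\<close>
        have "(\<lambda>n. infdist (Mhat n \<omega>) ?R) \<longlonglongrightarrow> infdist M0 ?R"
          by (intro tendsto_infdist elim)
        then have "(\<lambda>n. norm (Mhat n \<omega> - ?B n)) \<longlonglongrightarrow> 0"
          using truncate(2)[OF elim(4)] rank by simp
        from tendsto_diff[OF elim(3) tendsto_norm_zero_cancel[OF this]]
        have "(\<lambda>n. Mhat n \<omega> - (Mhat n \<omega> - ?B n)) \<longlonglongrightarrow> M0 - 0" .
        then have "?B \<longlonglongrightarrow> M0" by simp
        then have "(\<lambda>n. measure (KW n \<omega>) {w. f n (?B n) w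
            \<le> x}) \<longlonglongrightarrow> cdf ?G x"
          using KW[OF elim(4)] elim(2) truncate(1)[OF elim(4)]
          by (intro mapping) (auto simp: \<nu>_def)
        then show ?case using elim(1) by simp
      qed
    qed
  qed
  have H1: "(\<lambda>n. measure M {\<omega> \<in> space M. Lamhat n \<omega> > quantile (KL n
      \<omega>) \<alpha>}) \<longlonglongrightarrow> 1"
    if rank: "rank M0 > m"
  proof -
    \<comment> \<open>This positive distance makes the statistic grow linearly in
      \<open>n\<close>.\<close>
    have \<delta>: "0 < infdist M0 ?R"
    proof (rule infdist_pos_not_in_closed[OF closed_rank_le])
      show "?R \<noteq> {}" using rank_zero_le by blast
    qed (use rank in simp)
    \<comment> \<open>For large \<open>n\<close> the conditional law of \<open>Wstar\<close> puts
      mass less than \<open>1 - \<alpha>\<close> beyond \<open>r\<close>, so \<open>r^2\<close> will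
      bound the bootstrap quantile; \<open>r\<close> is the same for almost every
      \<open>\<omega>\<close>.\<close>
    obtain r where r: "\<And>\<mu>. (\<And>n. prob_space (\<mu> n))
        \<Longrightarrow> (\<And>n. sets (\<mu> n) = sets borel) \<Longrightarrow>
        conv_in_law \<mu> \<nu> \<Longrightarrow> \<forall>\<^sub>F n in sequentially. measure
            (\<mu> n) {w. r < norm w} < 1 - \<alpha>"
      by (rule conv_in_law_tight[OF \<nu>, of "1 - \<alpha>"]) (use level(2) that in auto)
    note [measurable] = borel_measurable_quantile[OF KLM level]
    let ?q = "\<lambda>n \<omega>. quantile (KL n \<omega>) \<alpha>"
    let ?D = "\<lambda>n. {\<omega> \<in> space M. Lamhat n \<omega> \<le> ?q n \<omega>}"
    have "(\<lambda>n. measure M (?D n)) \<longlonglongrightarrow> 0"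
    proof (rule measure_tendsto_0_if_AE_eventually_notin[OF prob])
      show "AE \<omega> in M. \<forall>\<^sub>F n in sequentially. \<omega> \<notin> ?D n"
        using cdf_KL[of "r\<^sup>2"] Wstar_law Mhat_as AE_space
      proof eventually_elim
        case (elim \<omega>)
        have "\<forall>\<^sub>F n in sequentially. measure (KW n \<omega>) {w. r < norm w} < 1 - \<alpha>"
          using r[of "\<lambda>n. KW n \<omega>"] KW[OF elim(4)] elim(2) by (simp add: \<nu>_def)
        moreover have "\<forall>\<^sub>F n in sequentially. r\<^sup>2 < Lamhat n \<omega>"
        proof -
          have "(\<lambda>n. (infdist (Mhat n \<omega>) ?R)\<^sup>2)
              \<longlonglongrightarrow> (infdist M0 ?R)\<^sup>2"
            by (intro tendsto_power tendsto_infdist elim)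
          then have "filterlim (\<lambda>n. (infdist (Mhat n \<omega>) ?R)\<^sup>2 * real n) at_top
              sequentially"
            by (rule filterlim_tendsto_pos_mult_at_top[OF _ _ filterlim_real_sequentially])
              (use \<delta> in simp)
          then show ?thesis
            using Lamhat_eq[OF elim(4)] by (simp add: filterlim_at_top_dense mult.commute)
        qed
        ultimately show ?case
        proof eventually_elim
          case n: (elim n)
          interpret KWn: prob_space "KW n \<omega>" by (rule KW[OF elim(4)])
          have sets: "sets (KW n \<omega>) = sets borel" by (rule KW[OF elim(4)])
          have sp: "space (KW n \<omega>) = UNIV" using sets_eq_imp_space_eq[OF sets] by simp
          let ?B = "P1 n \<omega> ** Mhat n \<omega> ** P2 n \<omega>"
          \<comment> \<open>The centre has rank at most \<open>m\<close> and is itself a competitor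
            for the distance, whatever the rank of \<open>M0\<close>. The factors of
            \<open>n\<close> cancel for \<open>n > 0\<close>, and at \<open>n = 0\<close> the left
            side is 0.\<close>
          have f_le: "f n ?B w \<le> (norm w)\<^sup>2" for w
          proof -
            have "infdist (?B + (1 / sqrt (real n)) *\<^sub>R w) ?R
                \<le> dist (?B + (1 / sqrt (real n)) *\<^sub>R w) ?B"
              using truncate(1)[OF elim(4)] by (intro infdist_le) simp
            also have "\<dots> = norm w / sqrt (real n)" by (simp add: dist_norm)
            finally have "f n ?B w \<le> real n * (norm w / sqrt (real n))\<^sup>2"
              unfolding f_def by (intro mult_left_mono power_mono infdist_nonneg) auto
            also have "\<dots> \<le> (norm w)\<^sup>2" by (simp add: power_divide)
            finally show ?thesis .
          qed
          \<comment> \<open>The ball of radius \<open>r\<close> carries more than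
            \<open>\<alpha>\<close> of the conditional mass, and on it the bootstrap statistic is at
            most \<open>r^2\<close>.\<close>
          have "\<alpha> < 1 - measure (KW n \<omega>) {w. r < norm w}" using n(1) by simp
          also have "\<dots> = measure (KW n \<omega>) (space (KW n \<omega>) - {w. r < norm w})"
            by (rule KWn.prob_compl[symmetric]) (simp add: sets)
          also have "\<dots> \<le> measure (KW n \<omega>) {w. f n ?B w \<le> r\<^sup>2}"
          proof (rule KWn.finite_measure_mono)
            show "space (KW n \<omega>) - {w. r < norm w} \<subseteq> {w. f n ?B w \<le> r\<^sup>2}"
              using f_le by (auto simp: not_less intro!: order_trans[OF f_le] power_mono)
            show "{w. f n ?B w \<le> r\<^sup>2} \<in> sets (KW n \<omega>)"
              unfolding sets using f_meas1[of n ?B] by simp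
          qed
          also have "\<dots> = cdf (KL n \<omega>) (r\<^sup>2)" using elim(1) by simp
          finally have "?q n \<omega> \<le> r\<^sup>2"
            using quantile_le_iff[OF prob_algebra_borelD[OF KLM elim(4)] level] by simp
          with n(2) show ?case by simp
        qed
      qed
    qed measurable
    then have "(\<lambda>n. 1 - measure M (?D n)) \<longlonglongrightarrow> 1 - 0" by (intro tendsto_intros)
    moreover have "measure M {\<omega> \<in> space M. Lamhat n \<omega> > ?q n \<omega>}
        = 1 - measure M (?D n)" for n
    proof -
      have "{\<omega> \<in> space M. Lamhat n \<omega> > ?q n \<omega>} = space M - ?D n" by auto
      then show ?thesis by (simp only:) (rule M.prob_compl, measurable)
    qed
    ultimately show ?thesis by simp
  qed
  show ?thesis using H0 H1 by blast
qed

end
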